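(* Let $X$ be a co-analytic separable metrizable space, and let $S=S_X$ be the type-space functor of $X$. Then $S$ has the game omitting types property if and only if $S$ has the strong omitting types property.
   Context: A subset of a Polish space is analytic if it is a continuous image of ${}^\omega\omega$, and co-analytic if its complement is analytic; a separable metrizable space is co-analytic if it is homeomorphic to a co-analytic subset of some Polish space. Regard each natural number $n$ as the set $\{0,\dots,n-1\}$. The type-space functor $S=S_X$ of a space $X$ has $S_n=X^n$ and, for $f:n\to m$, $(Sf)(x_0,\dots,x_{m-1})=(x_{f(0)},\dots,x_{f(n-1)})$. For $n\le m$, $\iota_{n,m}:n\to m$ is the inclusion; $S_\omega=\{(a_n)_{n<\omega}\in\prod_n S_n : a_n=(S\iota_{n,m})(a_m)\ \forall n<m\}$ (homeomorphic to $X^\omega$); for $f:n\to\omega$, $(Sf)((a_j)_j)=(Sf')(a_m)$ where $f[n]\subseteq m$ and $f':n\to m$ agrees with $f$. A model of size $\omega$ for $S$ is a function $M$ on $[\omega]^{<\omega}$ such that for every $A=\{a_0<\dots<a_{n-1}\}\in[\omega]^n$: (1) $M(A)\in S_n$; (2) if $B=\{b_0<\dots<b_{m-1}\}\supseteq A$ and $g:n\to m$ satisfies $a_i=b_{g(i)}$ then $M(A)=(Sg)(M(B))$; (3) for every $m\ge n$ and open $U\subseteq(S\iota_{n,m})^{-1}(\{M(A)\})$ there are $B=\{b_0<\dots<b_{m-1}\}\in[\omega]^m$, $B\supseteq A$, and a permutation $g$ of $m$ with $a_i=b_{g(i)}$ for $i<n$ and $(Sg)(M(B))\in U$. For $\sigma\in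 S_\omega$, $M_\sigma(A)=(Sf_A)(\sigma)$ where $f_A$ enumerates $A$ increasingly; $S_{\mathcal W}=\{\sigma\in S_\omega: M_\sigma\text{ is a model}\}$. Strong omitting types property: for every closed $C\subseteq S_\omega$ and every $E\subseteq C$ meagre in $C$ there is $\sigma\in S_{\mathcal W}\cap C$ with $\sigma\notin E$. Game omitting types property: a partial $\omega$-type is a closed subset of $S_\omega$; for a partial $\omega$-type $C$, $F\subseteq S_\omega$ is omissible in a model realizing $C$ if some $\sigma\in S_{\mathcal W}\cap C$ has $\sigma\notin F$; in the omitting types game on $C$, REALIZE and OMIT alternately choose partial $\omega$-types $F_0\subseteq F_1\subseteq\cdots$, REALIZE first, each omissible in a model realizing $C$, and OMIT wins if $\bigcup_n F_n$ is omissible in a model realizing $C$; $S$ has the property if OMIT has a winning strategy for every $C$.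
   Formalization: In the strong omitting types property, C ranges only over nonempty closed sets that are the closure of S_W ∩ C (for all closed C it fails for every X: C = E = ∅); in clause (3) of a model, U is nonempty and relatively open in the fibre; REALIZE loses if it has no legal first move. *)

theory Defs
  imports "HOL-Analysis.Analysis"
begin

definition Polish_space :: "'b topology \<Rightarrow> bool" where
  "Polish_space Y \<longleftrightarrow> completely_metrizable_space Y \<and> separable_space Y"

abbreviation Baire_topology :: "(nat \<Rightarrow> nat) topology" where
  "Baire_topology \<equiv> product_topology (\<lambda>_. discrete_topology UNIV) UNIV"

text \<open>Read literally, the empty set is not a continuous image of the Baire space. This does not
  affect which spaces are co-analytic: add an isolated point to the ambient Polish space.\<close>

definition analytic_in :: "'b topology \<Rightarrow> 'b set \<Rightarrow> bool" where
  "analytic_in Y A \<longleftrightarrow>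
     (\<exists>f. continuous_map Baire_topology Y f \<and> A = f ` topspace Baire_topology)"

definition coanalytic_in :: "'b topology \<Rightarrow> 'b set \<Rightarrow> bool" where
  "coanalytic_in Y A \<longleftrightarrow> A \<subseteq> topspace Y \<and> analytic_in Y (topspace Y - A)"

definition nowhere_dense_in :: "'b topology \<Rightarrow> 'b set \<Rightarrow> bool" where
  "nowhere_dense_in T N \<longleftrightarrow> N \<subseteq> topspace T \<and> T interior_of (T closure_of N) = {}"

definition meagre_in :: "'b topology \<Rightarrow> 'b set \<Rightarrow> bool" where
  "meagre_in T E \<longleftrightarrow> (\<exists>\<N>. countable \<N> \<and> (\<forall>N\<in>\<N>. nowhere_dense_in T N) \<and> E = \<Union>\<N>)"

text \<open>A point of $X^n$ is a function on \<open>{..<n}\<close>, extended by \<open>undefined\<close>. A map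
  $f : n \to m$ is a function on the naturals of which only the values on \<open>{..<n}\<close> matter; its
  codomain is not needed to compute $Sf$. In particular, \<open>id\<close> serves as the inclusion
  $\iota_{n,m}$.\<close>

definition type_space :: "'a topology \<Rightarrow> nat \<Rightarrow> (nat \<Rightarrow> 'a) topology" where
  "type_space X n = product_topology (\<lambda>_. X) {..<n}"

definition type_map :: "nat \<Rightarrow> (nat \<Rightarrow> nat) \<Rightarrow> (nat \<Rightarrow> 'a) \<Rightarrow> (nat \<Rightarrow> 'a)" where
  "type_map n f x = (\<lambda>i\<in>{..<n}. x (f i))"

definition omega_types :: "'a topology \<Rightarrow> (nat \<Rightarrow> nat \<Rightarrow> 'a) topology" where
  "omega_types X =
     subtopology (product_topology (type_space X) UNIV)
       {a. \<forall>n m. n < m \<longrightarrow> a n = type_map n id (a m)}"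

text \<open>$Sf$ for $f : n \to \omega$. By coherence of \<open>a\<close>, any $m$ with $f[n] \subseteq m$ gives the
  same value; the least one is taken.\<close>

definition omega_type_map ::
    "nat \<Rightarrow> (nat \<Rightarrow> nat) \<Rightarrow> (nat \<Rightarrow> nat \<Rightarrow> 'a) \<Rightarrow> (nat \<Rightarrow> 'a)" where
  "omega_type_map n f a = type_map n f (a (LEAST m. f ` {..<n} \<subseteq> {..<m}))"

definition enum_set :: "nat set \<Rightarrow> nat \<Rightarrow> nat" where
  "enum_set A i = sorted_list_of_set A ! i"

text \<open>Only the values of \<open>M\<close> at finite sets matter. In the third clause \<open>U\<close> is a nonempty
  relatively open subset of the fibre of the restriction map over \<open>M A\<close>.\<close>

definition is_model :: "'a topology \<Rightarrow> (nat set \<Rightarrow> nat \<Rightarrow> 'a) \<Rightarrow> bool" where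
  "is_model X M \<longleftrightarrow>
     (\<forall>A. finite A \<longrightarrow>
        M A \<in> topspace (type_space X (card A)) \<and>
        (\<forall>B g. finite B \<and> A \<subseteq> B \<and> g ` {..<card A} \<subseteq> {..<card B} \<and>
               (\<forall>i<card A. enum_set A i = enum_set B (g i)) \<longrightarrow>
               M A = type_map (card A) g (M B)) \<and>
        (\<forall>m\<ge>card A. \<forall>U.
           openin (subtopology (type_space X m) {x. type_map (card A) id x = M A}) U \<and> U \<noteq> {} \<longrightarrow>
           (\<exists>B g. finite B \<and> card B = m \<and> A \<subseteq> B \<and> g permutes {..<m} \<and>
                  (\<forall>i<card A. enum_set A i = enum_set B (g i)) \<and>
                  type_map m g (M B) \<in> U)))"

definition model_of :: "(nat \<Rightarrow> nat \<Rightarrow> 'a) \<Rightarrow> nat set \<Rightarrow> nat \<Rightarrow> 'a" where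
  "model_of \<sigma> A = omega_type_map (card A) (enum_set A) \<sigma>"

definition S_W :: "'a topology \<Rightarrow> (nat \<Rightarrow> nat \<Rightarrow> 'a) set" where
  "S_W X = {\<sigma> \<in> topspace (omega_types X). is_model X (model_of \<sigma>)}"

text \<open>The closed set \<open>C\<close> is required to be nonempty and to be the closure of its points that give
  models. Over all closed sets the property would fail for every space (\<open>C\<close> empty, or, if the space
  has two points, \<open>C\<close> the singleton of a constant sequence). Equivalently, for every closed \<open>C\<close>
  that meets \<open>S_W X\<close>, the set $S_W \cap C$ is not meagre in itself.\<close>

definition strong_omitting_types :: "'a topology \<Rightarrow> bool" where
  "strong_omitting_types X \<longleftrightarrow>
     (\<forall>C E. closedin (omega_types X) C \<and> C \<noteq> {} \<and>
            C = omega_types X closure_of (S_W X \<inter> C) \<and>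
            E \<subseteq> C \<and> meagre_in (subtopology (omega_types X) C) E \<longrightarrow>
            (\<exists>\<sigma>\<in>S_W X \<inter> C. \<sigma> \<notin> E))"

definition partial_type :: "'a topology \<Rightarrow> (nat \<Rightarrow> nat \<Rightarrow> 'a) set \<Rightarrow> bool" where
  "partial_type X F \<longleftrightarrow> closedin (omega_types X) F"

definition omissible ::
    "'a topology \<Rightarrow> (nat \<Rightarrow> nat \<Rightarrow> 'a) set \<Rightarrow> (nat \<Rightarrow> nat \<Rightarrow> 'a) set \<Rightarrow> bool" where
  "omissible X C F \<longleftrightarrow> F \<subseteq> topspace (omega_types X) \<and> (\<exists>\<sigma>\<in>S_W X \<inter> C. \<sigma> \<notin> F)"

definition legal_move ::
    "'a topology \<Rightarrow> (nat \<Rightarrow> nat \<Rightarrow> 'a) set \<Rightarrow> (nat \<Rightarrow> (nat \<Rightarrow> nat \<Rightarrow> 'a) set) \<Rightarrow> nat \<Rightarrow> bool" where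
  "legal_move X C F k \<longleftrightarrow>
     partial_type X (F k) \<and> omissible X C (F k) \<and> (\<forall>j<k. F j \<subseteq> F k)"

text \<open>REALIZE makes the moves with even index and OMIT those with odd index. A strategy for OMIT
  maps the list of the moves made so far to the next move. It has to answer every legal position
  with a legal move, and every infinite legal play that follows it has to be won. If no point of
  \<open>C\<close> gives a model, REALIZE has no legal first move and every strategy wins.\<close>

definition omit_winning_strategy ::
    "'a topology \<Rightarrow> (nat \<Rightarrow> nat \<Rightarrow> 'a) set \<Rightarrow>
       ((nat \<Rightarrow> nat \<Rightarrow> 'a) set list \<Rightarrow> (nat \<Rightarrow> nat \<Rightarrow> 'a) set) \<Rightarrow> bool" where
  "omit_winning_strategy X C s \<longleftrightarrow>
     (\<forall>F. (\<forall>k. odd k \<longrightarrow> F k = s (map F [0..<k])) \<longrightarrow>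
          (\<forall>k. odd k \<and> (\<forall>j<k. legal_move X C F j) \<longrightarrow> legal_move X C F k) \<and>
          ((\<forall>k. legal_move X C F k) \<longrightarrow> omissible X C (\<Union>k. F k)))"

definition game_omitting_types :: "'a topology \<Rightarrow> bool" where
  "game_omitting_types X \<longleftrightarrow>
     (\<forall>C. partial_type X C \<longrightarrow> (\<exists>s. omit_winning_strategy X C s))"

end

theory Submission
  imports Defs
begin

text \<open>Identify $S_\omega$ with $X^\omega$. A sequence gives a model iff it visits every nonempty open
  subset of $X$ infinitely often, so $S_{\mathcal W}$ is a $G_\delta$. Put
  $Z = S_{\mathcal W} \cap C$. The omitting types game on $C$ is the Choquet game on $Z$: the
  complements in $Z$ of the moves form a decreasing sequence of nonempty open sets.

  If OMIT wins, let REALIZE add the closures of the nowhere dense pieces of $E$ one by one.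
  Conversely, embed $X^\omega$ into $Y^\omega$ and let $Q$ be the closure of $Z$. The strong omitting
  types property says that $Z$ is nonmeagre in every nonempty open subset of $Q$. As $Q$ consists
  of $Z$, countably many preimages of the analytic set $Y \setminus A$, and a meagre set, and
  analytic sets have the Baire property, these preimages are meagre, hence $Z$ is comeagre in $Q$.
  OMIT wins by playing so that the closures in $Q$ shrink to a single point and avoid the $n$-th
  nowhere dense set in the $n$-th move.\<close>

subsection \<open>Meagre sets\<close>

text \<open>The form used throughout: closures are replaced by the option of shrinking an open set.
  From left to right the witness is \<open>W\<close> minus the closure of \<open>N\<close>.\<close>

lemma nowhere_dense_in_iff:
  "nowhere_dense_in T N \<longleftrightarrow>
     N \<subseteq> topspace T \<and>
     (\<forall>W. openin T W \<and> W \<noteq> {} \<longrightarrow> (\<exists>V. openin T V \<and> V \<noteq> {} \<and> V \<subseteq> W \<and> V \<inter> N = {}))"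
    (is "?L \<longleftrightarrow> ?R")
proof
  assume L: ?L
  show ?R
  proof (intro conjI allI impI)
    show "N \<subseteq> topspace T"
      using L by (simp add: nowhere_dense_in_def)
    fix W assume W: "openin T W \<and> W \<noteq> {}"
    let ?V = "W - T closure_of N"
    have "\<not> W \<subseteq> T closure_of N"
      using L W interior_of_maximal[of W "T closure_of N" T] by (auto simp: nowhere_dense_in_def)
    moreover have "openin T ?V"
      using W by (simp add: openin_diff)
    moreover have "?V \<inter> N = {}"
      using closure_of_subset[of N T] L by (auto simp: nowhere_dense_in_def)
    ultimately show "\<exists>V. openin T V \<and> V \<noteq> {} \<and> V \<subseteq> W \<and> V \<inter> N = {}"
      by (intro exI[of _ ?V]) auto
  qed
next
  assume R: ?R
  have "T interior_of (T closure_of N) = {}"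
  proof (rule ccontr)
    assume "T interior_of (T closure_of N) \<noteq> {}"
    then obtain V where V: "openin T V" "V \<noteq> {}" "V \<subseteq> T interior_of (T closure_of N)" "V \<inter> N = {}"
      using R by (metis openin_interior_of)
    then have "V \<subseteq> T closure_of N"
      using interior_of_subset by fastforce
    then show False
      using V openin_Int_closure_of_eq_empty[of T V N] by blast
  qed
  with R show ?L
    by (simp add: nowhere_dense_in_def)
qed

lemma nowhere_dense_in_closure_of:
  "nowhere_dense_in T N \<Longrightarrow> nowhere_dense_in T (T closure_of N)"
  by (simp add: nowhere_dense_in_def closure_of_subset_topspace)

lemma nowhere_dense_in_subset:
  "nowhere_dense_in T N \<Longrightarrow> N' \<subseteq> N \<Longrightarrow> nowhere_dense_in T N'"
  unfolding nowhere_dense_in_iff by (meson Int_mono disjoint_iff subset_iff)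

lemma nowhere_dense_in_closed_diff_interior:
  assumes "closedin T D"
  shows "nowhere_dense_in T (D - T interior_of D)"
  unfolding nowhere_dense_in_iff
proof (intro conjI allI impI)
  show "D - T interior_of D \<subseteq> topspace T"
    using assms closedin_subset by blast
  fix W assume W: "openin T W \<and> W \<noteq> {}"
  show "\<exists>V. openin T V \<and> V \<noteq> {} \<and> V \<subseteq> W \<and> V \<inter> (D - T interior_of D) = {}"
  proof (cases "W \<subseteq> D")
    case True
    then show ?thesis
      using W interior_of_maximal[of W D T] by (intro exI[of _ W]) auto
  next
    case False
    then show ?thesis
      using W assms by (intro exI[of _ "W - D"]) (auto simp: openin_diff)
  qed
qed

lemma meagre_in_nowhere_dense: "nowhere_dense_in T N \<Longrightarrow> meagre_in T N"
  unfolding meagre_in_def by (intro exI[of _ "{N}"]) auto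

lemma meagre_in_subset:
  assumes "meagre_in T E" "E' \<subseteq> E"
  shows "meagre_in T E'"
proof -
  obtain \<N> where N: "countable \<N>" "\<forall>N\<in>\<N>. nowhere_dense_in T N" "E = \<Union>\<N>"
    using assms by (auto simp: meagre_in_def)
  show ?thesis
    unfolding meagre_in_def
  proof (intro exI[of _ "(\<lambda>N. N \<inter> E') ` \<N>"] conjI)
    show "\<forall>N\<in>(\<lambda>N. N \<inter> E') ` \<N>. nowhere_dense_in T N"
      using N nowhere_dense_in_subset by blast
  qed (use N assms in auto)
qed

lemma meagre_in_UN:
  assumes "countable I" "\<And>i. i \<in> I \<Longrightarrow> meagre_in T (E i)"
  shows "meagre_in T (\<Union>i\<in>I. E i)"
proof -
  have "\<forall>i\<in>I. \<exists>\<N>. countable \<N> \<and> (\<forall>N\<in>\<N>. nowhere_dense_in T N) \<and> E i = \<Union>\<N>"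
    using assms(2) by (simp add: meagre_in_def)
  then obtain \<N> where
    N: "\<forall>i\<in>I. countable (\<N> i) \<and> (\<forall>N\<in>\<N> i. nowhere_dense_in T N) \<and> E i = \<Union>(\<N> i)"
    by metis
  show ?thesis
    unfolding meagre_in_def
    by (intro exI[of _ "\<Union>i\<in>I. \<N> i"]) (use N assms(1) in auto)
qed

lemma meagre_in_Un:
  assumes "meagre_in T E" "meagre_in T E'"
  shows "meagre_in T (E \<union> E')"
proof -
  have "meagre_in T (\<Union>b\<in>UNIV. if b then E else E')"
    by (rule meagre_in_UN) (use assms in auto)
  moreover have "(\<Union>b\<in>UNIV. if b then E else E') = E \<union> E'"
    by (auto split: if_splits)
  ultimately show ?thesis
    by simp
qed

lemma meagre_in_empty: "meagre_in T {}"
  unfolding meagre_in_def by (intro exI[of _ "{}"]) auto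

lemma meagre_in_nowhere_dense_sequence:
  assumes "meagre_in T E"
  obtains N :: "nat \<Rightarrow> 'a set" where "\<And>n. nowhere_dense_in T (N n)" "E = (\<Union>n. N n)"
proof -
  obtain \<N> where N: "countable \<N>" "\<forall>N\<in>\<N>. nowhere_dense_in T N" "E = \<Union>\<N>"
    using assms by (auto simp: meagre_in_def)
  \<comment> \<open>Adjoining \<open>{}\<close> makes the family nonempty, as enumerating it by
    \<open>from_nat_into\<close> requires.\<close>
  have "nowhere_dense_in T {}"
    by (simp add: nowhere_dense_in_def)
  with N have *: "\<forall>N\<in>insert {} \<N>. nowhere_dense_in T N" "E = \<Union>(insert {} \<N>)" "countable (insert {} \<N>)"
    by auto
  show thesis
  proof (rule that[of "from_nat_into (insert {} \<N>)"])
    show "nowhere_dense_in T (from_nat_into (insert {} \<N>) n)" for n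
      using *(1) from_nat_into[of "insert {} \<N>" n] by blast
    show "E = (\<Union>n. from_nat_into (insert {} \<N>) n)"
      using *(2,3) range_from_nat_into[of "insert {} \<N>"] by simp
  qed
qed

subsection \<open>Analytic sets have the Baire property\<close>

text \<open>Delete from the space every basic open set in which \<open>B\<close> is meagre, and let
  \<open>G\<close> be the interior of the remainder \<open>D\<close>. By countability of the base,
  only a meagre part of \<open>B\<close> is deleted, and the boundary of \<open>D\<close> is nowhere
  dense. An open subset of \<open>G\<close> in which \<open>B\<close> is meagre would contain a
  deleted basic set. So \<open>G\<close> is an open hull of \<open>B\<close> up to meagre sets,
  whether or not \<open>B\<close> has the Baire property.\<close>

lemma category_kernel:
  assumes "second_countable T" "B \<subseteq> topspace T"
  shows "\<exists>G. openin T G \<and> meagre_in T (B - G) \<and>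
             (\<forall>W. openin T W \<and> W \<noteq> {} \<and> W \<subseteq> G \<longrightarrow> \<not> meagre_in T (W \<inter> B))"
proof -
  obtain \<B> where B: "countable \<B>" "\<forall>V\<in>\<B>. openin T V"
      "\<And>U x. openin T U \<Longrightarrow> x \<in> U \<Longrightarrow> \<exists>V\<in>\<B>. x \<in> V \<and> V \<subseteq> U"
    using assms(1) unfolding second_countable_def by metis
  define \<M> where "\<M> = {V\<in>\<B>. meagre_in T (V \<inter> B)}"
  define D where "D = topspace T - \<Union>\<M>"
  have D: "closedin T D"
    using B(2) by (auto simp: D_def \<M>_def intro!: closedin_diff)
  have "countable \<M>"
    using B(1) by (auto simp: \<M>_def intro: countable_subset)
  then have "meagre_in T (\<Union>V\<in>\<M>. V \<inter> B)"
    by (rule meagre_in_UN) (simp add: \<M>_def)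
  moreover have "meagre_in T (D - T interior_of D)"
    by (rule meagre_in_nowhere_dense[OF nowhere_dense_in_closed_diff_interior[OF D]])
  ultimately have "meagre_in T (B - T interior_of D)"
    by (rule meagre_in_subset[OF meagre_in_Un]) (use assms(2) in \<open>auto simp: D_def\<close>)
  moreover have "\<not> meagre_in T (W \<inter> B)" if W: "openin T W" "W \<noteq> {}" "W \<subseteq> T interior_of D" for W
  proof
    assume m: "meagre_in T (W \<inter> B)"
    obtain x where x: "x \<in> W"
      using W(2) by blast
    then obtain V where V: "V \<in> \<B>" "x \<in> V" "V \<subseteq> W"
      using B(3)[OF W(1)] by blast
    then have "V \<in> \<M>"
      using meagre_in_subset[OF m, of "V \<inter> B"] by (auto simp: \<M>_def)
    then show False
      using V(2,3) W(3) interior_of_subset[of T D] by (auto simp: D_def)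
  qed
  ultimately show ?thesis
    by (intro exI[of _ "T interior_of D"]) simp
qed

text \<open>Nikodym's argument that the Souslin operation preserves the Baire property. Every
  \<open>B s\<close> gets its category kernel \<open>G s\<close>; the kernels of the successors of
  \<open>s\<close> fill \<open>G s\<close> up to a nowhere dense set, and a point that never falls
  into such an error set follows a branch. Hypothesis \<open>branch\<close> then puts it into
  \<open>B []\<close>.\<close>

lemma Souslin_scheme_Baire_property:
  fixes B :: "nat list \<Rightarrow> 'b set"
  assumes sc: "second_countable T"
    and sub: "B [] \<subseteq> topspace T"
    and split: "\<And>s. B s = (\<Union>n. B (s @ [n]))"
    and branch: "\<And>\<alpha>. (\<Inter>k. T closure_of B (map \<alpha> [0..<k])) \<subseteq> B []"
  shows "\<exists>G. openin T G \<and> meagre_in T (B [] - G) \<and> meagre_in T (G - B [])"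
proof -
  have sub': "B s \<subseteq> topspace T" for s
  proof (induction s rule: rev_induct)
    case (snoc n s)
    have "B (s @ [n]) \<subseteq> B s"
      by (subst split[of s]) (rule UN_upper[OF UNIV_I])
    with snoc show ?case
      by (rule order_trans[rotated])
  qed (fact sub)
  have "\<forall>s. \<exists>G. openin T G \<and> meagre_in T (B s - G) \<and>
             (\<forall>W. openin T W \<and> W \<noteq> {} \<and> W \<subseteq> G \<longrightarrow> \<not> meagre_in T (W \<inter> B s))"
    using category_kernel[OF sc sub'] by blast
  then obtain G where
    G: "\<And>s. openin T (G s)" "\<And>s. meagre_in T (B s - G s)"
      "\<And>s W. openin T W \<Longrightarrow> W \<noteq> {} \<Longrightarrow> W \<subseteq> G s \<Longrightarrow> \<not> meagre_in T (W \<inter> B s)"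
    by metis
  txt \<open>A point of \<open>G []\<close> outside the meagre set \<open>M\<close> stays in \<open>G\<close> along an infinite branch, hence in the
    closures of the sets \<open>B\<close> along it.\<close>
  define M where "M = (\<Union>s. G s - (\<Union>n. G (s @ [n])))"
  have nd: "nowhere_dense_in T (G s - (\<Union>n. G (s @ [n])))" for s
    unfolding nowhere_dense_in_iff
  proof (intro conjI allI impI)
    show "G s - (\<Union>n. G (s @ [n])) \<subseteq> topspace T"
      using G(1) openin_subset by blast
    fix W assume W: "openin T W \<and> W \<noteq> {}"
    show "\<exists>V. openin T V \<and> V \<noteq> {} \<and> V \<subseteq> W \<and> V \<inter> (G s - (\<Union>n. G (s @ [n]))) = {}"
    proof (cases "W \<inter> G s = {}")
      case True
      then show ?thesis
        using W by (intro exI[of _ W]) auto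
    next
      case False
      \<comment> \<open>If \<open>W \<inter> G s\<close> missed the kernels of all successors, each
        \<open>B (s @ [n])\<close> would be meagre there, hence so would \<open>B s\<close>,
        although this open set lies in the kernel of \<open>B s\<close>.\<close>
      have "\<exists>n. W \<inter> G s \<inter> G (s @ [n]) \<noteq> {}"
      proof (rule ccontr)
        assume "\<nexists>n. W \<inter> G s \<inter> G (s @ [n]) \<noteq> {}"
        then have "(W \<inter> G s) \<inter> (\<Union>n. B (s @ [n])) \<subseteq> (\<Union>n. B (s @ [n]) - G (s @ [n]))"
          by blast
        then have "(W \<inter> G s) \<inter> B s \<subseteq> (\<Union>n. B (s @ [n]) - G (s @ [n]))"
          by (simp only: split[of s, symmetric])
        moreover have "meagre_in T (\<Union>n. B (s @ [n]) - G (s @ [n]))"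
          by (rule meagre_in_UN) (use G(2) in auto)
        ultimately have "meagre_in T ((W \<inter> G s) \<inter> B s)"
          by (rule meagre_in_subset[rotated])
        then show False
          using G(3)[of "W \<inter> G s" s] False W G(1) by (simp add: openin_Int)
      qed
      then obtain n where "W \<inter> G (s @ [n]) \<noteq> {}"
        by blast
      then show ?thesis
        using W G(1) by (intro exI[of _ "W \<inter> G (s @ [n])"]) (auto simp: openin_Int)
    qed
  qed
  have M: "meagre_in T M"
    unfolding M_def by (rule meagre_in_UN) (use nd meagre_in_nowhere_dense in auto)
  \<comment> \<open>A set that is nonmeagre in every nonempty open part of \<open>G s\<close> meets
    each of them.\<close>
  have Gcl: "G s \<subseteq> T closure_of B s" for s
  proof
    fix x assume x: "x \<in> G s"
    show "x \<in> T closure_of B s"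
      unfolding in_closure_of
    proof (intro conjI allI impI)
      show "x \<in> topspace T"
        using x G(1) openin_subset by blast
      fix U assume U: "x \<in> U \<and> openin T U"
      then have "\<not> meagre_in T ((U \<inter> G s) \<inter> B s)"
        using G(3)[of "U \<inter> G s" s] x G(1) by (auto simp: openin_Int)
      then have "(U \<inter> G s) \<inter> B s \<noteq> {}"
        using meagre_in_empty by metis
      then show "\<exists>y. y \<in> B s \<and> y \<in> U"
        by blast
    qed
  qed
  have "G [] - B [] \<subseteq> M"
  proof (rule ccontr)
    assume "\<not> G [] - B [] \<subseteq> M"
    then obtain x where x: "x \<in> G []" "x \<notin> B []" "x \<notin> M"
      by blast
    \<comment> \<open>The clause for \<open>k = 0\<close> anchors the branch at the root, so that
      \<open>L k\<close> is exactly the initial segment of length \<open>k\<close> of a single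
      \<alpha>.\<close>
    have "\<exists>L. \<forall>k. (x \<in> G (L k) \<and> (k = 0 \<longrightarrow> L k = [])) \<and> (\<exists>n. L (Suc k) = L k @ [n])"
    proof (rule dependent_nat_choice)
      show "\<exists>s. x \<in> G s \<and> (0 = (0::nat) \<longrightarrow> s = [])"
        using x by blast
      fix s and k :: nat
      assume "x \<in> G s \<and> (k = 0 \<longrightarrow> s = [])"
      then have "\<exists>n. x \<in> G (s @ [n])"
        using x(3) unfolding M_def by blast
      then show "\<exists>s'. (x \<in> G s' \<and> (Suc k = 0 \<longrightarrow> s' = [])) \<and> (\<exists>n. s' = s @ [n])"
        by auto
    qed
    then obtain L where L: "\<And>k. x \<in> G (L k)" "L 0 = []" "\<And>k. \<exists>n. L (Suc k) = L k @ [n]"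
      by blast
    then obtain \<alpha> where \<alpha>: "\<And>k. L (Suc k) = L k @ [\<alpha> k]"
      by metis
    have "L k = map \<alpha> [0..<k]" for k
      by (induction k) (auto simp: L(2) \<alpha>)
    then have "x \<in> (\<Inter>k. T closure_of B (map \<alpha> [0..<k]))"
      using L(1) Gcl by fastforce
    then show False
      using branch x(2) by blast
  qed
  then show ?thesis
    using G(1,2) meagre_in_subset[OF M] by blast
qed

lemma analytic_preimage_Baire_property:
  assumes sc: "second_countable T" and Y: "Hausdorff_space Y"
    and p: "continuous_map T Y p" and A: "analytic_in Y A"
  shows "\<exists>G. openin T G \<and> meagre_in T ({x \<in> topspace T. p x \<in> A} - G) \<and>
             meagre_in T (G - {x \<in> topspace T. p x \<in> A})"
proof -
  obtain f where f: "continuous_map Baire_topology Y f" "A = range f"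
    using A by (auto simp: analytic_in_def)
  define N where "N s = {\<alpha>::nat \<Rightarrow> nat. map \<alpha> [0..<length s] = s}" for s
  define B where "B s = {x \<in> topspace T. p x \<in> f ` N s}" for s
  have N_split: "N s = (\<Union>n. N (s @ [n]))" for s
    by (auto simp: N_def)
  have N_Nil: "N [] = UNIV"
    by (simp add: N_def)
  have nbhd: "\<exists>k. N (map \<alpha> [0..<k]) \<subseteq> V" if V: "openin Baire_topology V" "\<alpha> \<in> V" for \<alpha> V
  proof -
    obtain U where U: "finite {i. U i \<noteq> (UNIV :: nat set)}" "\<alpha> \<in> Pi\<^sub>E UNIV U" "Pi\<^sub>E UNIV U \<subseteq> V"
      using V unfolding openin_product_topology_alt by fastforce
    then obtain k where k: "\<And>i. U i \<noteq> UNIV \<Longrightarrow> i < k"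
      by (metis (mono_tags) finite_nat_set_iff_bounded mem_Collect_eq)
    have "N (map \<alpha> [0..<k]) \<subseteq> Pi\<^sub>E UNIV U"
    proof
      fix \<beta> assume "\<beta> \<in> N (map \<alpha> [0..<k])"
      then have "\<beta> i = \<alpha> i" if "i < k" for i
        using that by (simp add: N_def)
      then show "\<beta> \<in> Pi\<^sub>E UNIV U"
        using U(2) k by (auto simp: PiE_iff) (metis UNIV_I)
    qed
    with U show ?thesis
      by blast
  qed
  have "\<exists>G. openin T G \<and> meagre_in T (B [] - G) \<and> meagre_in T (G - B [])"
  proof (rule Souslin_scheme_Baire_property[OF sc])
    show "B [] \<subseteq> topspace T"
      by (auto simp: B_def)
    show "B s = (\<Union>n. B (s @ [n]))" for s
      using N_split[of s] by (auto simp: B_def)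
    fix \<alpha>
    show "(\<Inter>k. T closure_of B (map \<alpha> [0..<k])) \<subseteq> B []"
    proof
      fix x assume x: "x \<in> (\<Inter>k. T closure_of B (map \<alpha> [0..<k]))"
      then have xT: "x \<in> topspace T"
        by (auto simp: in_closure_of)
      have "p x = f \<alpha>"
      proof (rule ccontr)
        assume ne: "p x \<noteq> f \<alpha>"
        have "p x \<in> topspace Y" "f \<alpha> \<in> topspace Y"
          using p f(1) xT by (auto simp: continuous_map_def)
        then obtain U V where UV: "openin Y U" "openin Y V" "p x \<in> U" "f \<alpha> \<in> V" "disjnt U V"
          using Y ne unfolding Hausdorff_space_def by metis
        have "openin Baire_topology {\<beta>. f \<beta> \<in> V}"
          using openin_continuous_map_preimage[OF f(1) UV(2)] by simp
        then obtain k where k: "N (map \<alpha> [0..<k]) \<subseteq> {\<beta>. f \<beta> \<in> V}"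
          using nbhd[of "{\<beta>. f \<beta> \<in> V}" \<alpha>] UV(4) by blast
        have "openin T {z \<in> topspace T. p z \<in> U}"
          using openin_continuous_map_preimage[OF p UV(1)] .
        moreover have "x \<in> T closure_of B (map \<alpha> [0..<k])"
          using x by blast
        ultimately have "\<exists>z. z \<in> B (map \<alpha> [0..<k]) \<and> z \<in> {z \<in> topspace T. p z \<in> U}"
          using xT UV(3) unfolding in_closure_of by (metis (no_types, lifting) mem_Collect_eq)
        then obtain z where "z \<in> B (map \<alpha> [0..<k])" "p z \<in> U"
          by auto
        then show False
          using k UV(5) by (auto simp: B_def disjnt_iff)
      qed
      then show "x \<in> B []"
        using xT by (auto simp: B_def N_Nil)
    qed
  qed
  then show ?thesis
    by (simp add: B_def N_Nil f(2))
qed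

subsection \<open>The omitting types game\<close>

lemma omissible_iff:
  assumes "closedin (omega_types X) F"
  shows "omissible X C F \<longleftrightarrow> \<not> S_W X \<inter> C \<subseteq> F"
  using closedin_subset[OF assms] by (auto simp: omissible_def)

text \<open>This makes REALIZE's moves legal. The open set \<open>C - P\<close> of
  \<open>subtopology T C\<close> has a nonempty open part away from the closure of \<open>N\<close>,
  and \<open>Z\<close>, being dense in \<open>C\<close>, meets that part. On \<open>C\<close> the
  closures of \<open>N\<close> in \<open>T\<close> and in the subspace agree.\<close>

lemma dense_meets_complement_nowhere_dense:
  assumes P: "closedin T P" "\<not> Z \<subseteq> P" and Z: "C = T closure_of Z" "Z \<subseteq> C"
    and N: "nowhere_dense_in (subtopology T C) N"
  shows "\<not> Z \<subseteq> P \<union> T closure_of N"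
proof -
  let ?TC = "subtopology T C"
  have CT: "C \<subseteq> topspace T"
    using Z(1) closure_of_subset_topspace by metis
  have NC: "N \<subseteq> C"
    using N by (auto simp: nowhere_dense_in_def)
  have "openin ?TC (C - P)"
    using P(1) CT openin_diff[OF openin_topspace, of T P] unfolding openin_subtopology
    by (intro exI[of _ "topspace T - P"]) auto
  moreover have "C - P \<noteq> {}"
    using P(2) Z(2) by blast
  ultimately obtain V where V: "openin ?TC V" "V \<noteq> {}" "V \<subseteq> C - P" "V \<inter> ?TC closure_of N = {}"
    using nowhere_dense_in_closure_of[OF N] unfolding nowhere_dense_in_iff by meson
  obtain U where U: "openin T U" "V = U \<inter> C"
    using V(1) by (auto simp: openin_subtopology)
  obtain x where "x \<in> V"
    using V(2) by blast
  then have "\<exists>z. z \<in> Z \<and> z \<in> U"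
    using U Z(1) by (auto simp: in_closure_of)
  then obtain z where z: "z \<in> Z" "z \<in> V"
    using Z(2) U(2) by blast
  then have "z \<notin> P" "z \<notin> ?TC closure_of N"
    using V(3,4) by auto
  then show ?thesis
    using z Z(2) NC by (auto simp: closure_of_subtopology Int_absorb1)
qed

lemma game_imp_strong_omitting_types:
  assumes "game_omitting_types X"
  shows "strong_omitting_types X"
  unfolding strong_omitting_types_def
proof (intro allI impI)
  fix C E
  let ?T = "omega_types X"
  assume "closedin ?T C \<and> C \<noteq> {} \<and> C = ?T closure_of (S_W X \<inter> C) \<and>
            E \<subseteq> C \<and> meagre_in (subtopology ?T C) E"
  then have C: "closedin ?T C" "C \<noteq> {}" "C = ?T closure_of (S_W X \<inter> C)"
    and E: "meagre_in (subtopology ?T C) E"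
    by auto
  obtain N :: "nat \<Rightarrow> _" where
    N: "\<And>n. nowhere_dense_in (subtopology ?T C) (N n)" "E = (\<Union>n. N n)"
    using meagre_in_nowhere_dense_sequence[OF E] by metis
  have NT: "N n \<subseteq> topspace ?T" for n
    using N(1) by (auto simp: nowhere_dense_in_def)
  \<comment> \<open>The empty set is omissible; it serves as the predecessor of REALIZE's first
    move.\<close>
  have Z0: "\<not> S_W X \<inter> C \<subseteq> {}"
    using C(2,3) by (metis closure_of_empty subset_empty)
  obtain s where "omit_winning_strategy X C s"
    using assms C(1) by (auto simp: game_omitting_types_def partial_type_def)
  note s = this[unfolded omit_winning_strategy_def, rule_format]
  \<comment> \<open>The play is built by recursion on the whole history, because \<open>s\<close>
    may depend on all of it. At even length \<open>2 * n\<close>, REALIZE adds the closure of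
    \<open>N n\<close> to the last move.\<close>
  define nxt where "nxt L = (if odd (length L) then s L
      else (if L = [] then {} else last L) \<union> ?T closure_of (N (length L div 2)))" for L
  define L where "L = rec_nat [] (\<lambda>_ M. M @ [nxt M])"
  define F where "F k = nxt (L k)" for k
  have L: "L k = map F [0..<k]" for k
    by (induction k) (auto simp: L_def F_def)
  have odd: "F k = s (map F [0..<k])" if "odd k" for k
    using that by (simp add: F_def nxt_def L)
  have even: "F k = (if k = 0 then {} else F (k - 1)) \<union> ?T closure_of (N (k div 2))" if "even k" for k
    using that by (simp add: F_def[of k] nxt_def L last_map)
  have legal: "legal_move X C F k" for k
  proof (induction k rule: less_induct)
    case (less k)
    show ?case
    proof (cases "odd k")
      case True
      then show ?thesis
        using s[of F] odd less by blast
    next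
      case False
      define P where "P = (if k = 0 then {} else F (k - 1))"
      have Fk: "F k = P \<union> ?T closure_of (N (k div 2))"
        using even False by (simp add: P_def)
      have P: "closedin ?T P" "\<not> S_W X \<inter> C \<subseteq> P"
        using less[of "k - 1"] Z0
        by (auto simp: P_def legal_move_def partial_type_def omissible_iff)
      \<comment> \<open>The previous move is legal and so contains all earlier ones.\<close>
      have sub: "F j \<subseteq> P" if "j < k" for j
      proof (cases "j = k - 1")
        case False
        then show ?thesis
          using less[of "k - 1"] that by (auto simp: P_def legal_move_def)
      qed (use that in \<open>auto simp: P_def\<close>)
      have "closedin ?T (F k)"
        using P(1) by (simp add: Fk closedin_Un)
      moreover have "\<not> S_W X \<inter> C \<subseteq> F k"
        unfolding Fk using dense_meets_complement_nowhere_dense[OF P C(3) _ N(1)] by blast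
      ultimately show ?thesis
        using sub Fk by (auto simp: legal_move_def partial_type_def omissible_iff)
    qed
  qed
  then have "omissible X C (\<Union>k. F k)"
    using s[of F] odd by blast
  moreover have "E \<subseteq> (\<Union>k. F k)"
  proof -
    have "N n \<subseteq> F (2 * n)" for n
      using even[of "2 * n"] closure_of_subset[OF NT[of n]] by auto
    then show ?thesis
      using N(2) by blast
  qed
  ultimately show "\<exists>\<sigma>\<in>S_W X \<inter> C. \<sigma> \<notin> E"
    by (auto simp: omissible_def)
qed

text \<open>The topology \<open>Z\<close> inherits from \<open>T\<close> is the initial one along \<open>h\<close>; if \<open>T\<close> is \<open>T\<^sub>0\<close>, then \<open>h\<close>
  is automatically injective on \<open>Z\<close>.\<close>

locale dense_copy =
  fixes T :: "'a topology" and Z :: "'a set" and Q :: "'b topology" and h :: "'a \<Rightarrow> 'b"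
  assumes Z_subset: "Z \<subseteq> topspace T"
    and h_range: "h ` Z \<subseteq> topspace Q"
    and open_image: "openin T V \<Longrightarrow> \<exists>W. openin Q W \<and> (\<forall>z\<in>Z. h z \<in> W \<longleftrightarrow> z \<in> V)"
    and open_preimage: "openin Q W \<Longrightarrow> \<exists>V. openin T V \<and> (\<forall>z\<in>Z. z \<in> V \<longleftrightarrow> h z \<in> W)"
    and dense: "openin Q W \<Longrightarrow> W \<noteq> {} \<Longrightarrow> \<exists>z\<in>Z. h z \<in> W"
begin

lemma response:
  assumes M: "Metric_space M d" and Q: "Q = Metric_space.mtopology M d"
    and F: "closedin T F" "\<not> Z \<subseteq> F" and N: "nowhere_dense_in Q N" and e: "e > 0"
  shows "\<exists>F'. closedin T F' \<and> F \<subseteq> F' \<and> \<not> Z \<subseteq> F' \<and>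
     (\<forall>z\<in>Z. h z \<in> Q closure_of (h ` (Z - F')) \<longrightarrow> z \<notin> F) \<and>
     Q closure_of (h ` (Z - F')) \<inter> N = {} \<and>
     (\<exists>a. Q closure_of (h ` (Z - F')) \<subseteq> Metric_space.mcball M d a e)"
proof -
  interpret Metric_space M d
    by (fact M)
  obtain U where U: "openin Q U" "\<And>z. z \<in> Z \<Longrightarrow> h z \<in> U \<longleftrightarrow> z \<in> topspace T - F"
    using open_image[OF openin_diff[OF openin_topspace F(1)]] by blast
  have "U \<noteq> {}"
    using U(2) F(2) Z_subset by blast
  then obtain W where W: "openin Q W" "W \<noteq> {}" "W \<subseteq> U" "W \<inter> N = {}"
    using N U(1) unfolding nowhere_dense_in_iff by meson
  then obtain p r where p: "p \<in> W" "r > 0" "mball p r \<subseteq> W"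
    unfolding Q openin_mtopology by blast
  have pM: "p \<in> M"
    using p(1) W(1) unfolding Q openin_mtopology by blast
  \<comment> \<open>Halving \<open>r\<close> puts the closed ball of radius \<open>\<rho>\<close>
    inside the open ball of radius \<open>r\<close>, hence inside \<open>W\<close>.\<close>
  define \<rho> where "\<rho> = min (r / 2) e"
  have \<rho>: "\<rho> > 0" "\<rho> \<le> e" "\<rho> < r"
    using p(2) e by (auto simp: \<rho>_def)
  have ball: "mball p \<rho> \<subseteq> mcball p \<rho>" "mcball p \<rho> \<subseteq> W" "mcball p \<rho> \<subseteq> mcball p e"
    using \<rho> p(3) by (force simp: mball_def mcball_def)+
  obtain G where G: "openin T G" "\<And>z. z \<in> Z \<Longrightarrow> z \<in> G \<longleftrightarrow> h z \<in> mball p \<rho>"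
    using open_preimage[of "mball p \<rho>"] unfolding Q by auto
  define F' where "F' = F \<union> (topspace T - G)"
  have closed: "closedin T F'"
    using F(1) G(1) by (auto simp: F'_def intro!: closedin_Un closedin_diff)
  have "h ` (Z - F') \<subseteq> mcball p \<rho>"
    using G(2) Z_subset ball(1) by (auto simp: F'_def)
  then have cl: "Q closure_of (h ` (Z - F')) \<subseteq> mcball p \<rho>"
    unfolding Q by (rule closure_of_minimal) simp
  have "p \<in> mball p \<rho>"
    using pM \<rho> by simp
  then obtain z where z: "z \<in> Z" "h z \<in> mball p \<rho>"
    using dense[of "mball p \<rho>"] unfolding Q by (metis empty_iff openin_mball)
  moreover have "h z \<in> U"
    using z(2) ball(1,2) W(3) by blast
  ultimately have "z \<notin> F'"
    using G(2) U(2) by (auto simp: F'_def)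
  show ?thesis
  proof (intro exI[of _ F'] conjI)
    show "\<forall>z\<in>Z. h z \<in> Q closure_of (h ` (Z - F')) \<longrightarrow> z \<notin> F"
      using cl ball(2) W(3) U(2) by blast
    show "Q closure_of (h ` (Z - F')) \<inter> N = {}"
      using cl ball(2) W(4) by blast
    show "\<exists>a. Q closure_of (h ` (Z - F')) \<subseteq> mcball a e"
      using cl ball(3) by blast
  qed (use closed z \<open>z \<notin> F'\<close> in \<open>auto simp: F'_def\<close>)
qed

end

text \<open>The closures left by OMIT's replies decrease and have vanishing radii, so completeness
  of \<open>Q\<close> gives a common point \<open>q\<close>. It avoids every \<open>N n\<close>,
  which forces \<open>q = h z\<close> with \<open>z \<in> Z\<close>, and the closure condition in
  \<open>ok\<close> keeps \<open>z\<close> out of all moves.\<close>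

lemma omit_winning_strategy_comeagre:
  assumes dc: "dense_copy (omega_types X) (S_W X \<inter> C) Q h"
    and cm: "completely_metrizable_space Q"
    and meagre: "meagre_in Q (topspace Q - h ` (S_W X \<inter> C))"
  shows "\<exists>s. omit_winning_strategy X C s"
proof -
  let ?T = "omega_types X"
  define Z where "Z = S_W X \<inter> C"
  interpret dense_copy ?T Z Q h
    using dc by (simp add: Z_def)
  obtain M d where Md: "Metric_space M d" "Metric_space.mcomplete M d" "Q = Metric_space.mtopology M d"
    using cm unfolding completely_metrizable_space_def by blast
  interpret Metric_space M d
    by (fact Md(1))
  obtain N where N: "\<And>n::nat. nowhere_dense_in Q (N n)" "topspace Q - h ` Z = (\<Union>n. N n)"
    using meagre_in_nowhere_dense_sequence[OF meagre] unfolding Z_def by metis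
  \<comment> \<open>Here \<open>k\<close> is the index of OMIT's move. For
    \<open>k = 2 * n + 1\<close> the quotient \<open>k div 2\<close> is \<open>n\<close>, so every
    \<open>N n\<close> gets its turn.\<close>
  define ok where "ok k F F' \<longleftrightarrow> closedin ?T F' \<and> F \<subseteq> F' \<and> \<not> Z \<subseteq> F' \<and>
     (\<forall>z\<in>Z. h z \<in> Q closure_of (h ` (Z - F')) \<longrightarrow> z \<notin> F) \<and>
     Q closure_of (h ` (Z - F')) \<inter> N (k div 2) = {} \<and>
     (\<exists>a. Q closure_of (h ` (Z - F')) \<subseteq> mcball a (inverse (Suc k)))" for k F F'
  have "\<forall>k F. \<exists>F'. closedin ?T F \<and> \<not> Z \<subseteq> F \<longrightarrow> ok k F F'"
    using response[OF Md(1,3) _ _ N(1)] unfolding ok_def by auto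
  then obtain R where R: "\<And>k F. closedin ?T F \<Longrightarrow> \<not> Z \<subseteq> F \<Longrightarrow> ok k F (R k F)"
    by metis
  \<comment> \<open>OMIT looks only at the last move and at the number of moves. OMIT's positions
    have odd length, so \<open>last\<close> is applied to nonempty lists.\<close>
  have "omit_winning_strategy X C (\<lambda>L. R (length L) (last L))"
    unfolding omit_winning_strategy_def
  proof (intro allI impI)
    fix F :: "nat \<Rightarrow> _"
    assume "\<forall>k. odd k \<longrightarrow> F k = R (length (map F [0..<k])) (last (map F [0..<k]))"
    then have F: "F k = R k (F (k - 1))" if "odd k" for k
      using that by (auto simp: last_map odd_pos)
    have legalD: "closedin ?T (F k)" "\<not> Z \<subseteq> F k" "\<And>j. j < k \<Longrightarrow> F j \<subseteq> F k"
      if "legal_move X C F k" for k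
      using that by (auto simp: legal_move_def partial_type_def omissible_iff Z_def)
    have ok: "ok k (F (k - 1)) (F k)" if "odd k" "legal_move X C F (k - 1)" for k
      using R[OF legalD(1,2)[OF that(2)], of k] F[OF that(1)] by simp
    show "(\<forall>k. odd k \<and> (\<forall>j<k. legal_move X C F j) \<longrightarrow> legal_move X C F k) \<and>
          ((\<forall>k. legal_move X C F k) \<longrightarrow> omissible X C (\<Union>k. F k))"
    proof (intro conjI allI impI)
      fix k assume k: "odd k \<and> (\<forall>j<k. legal_move X C F j)"
      then have l: "legal_move X C F (k - 1)"
        by (simp add: odd_pos)
      have o: "closedin ?T (F k)" "F (k - 1) \<subseteq> F k" "\<not> Z \<subseteq> F k"
        using ok[OF _ l] k by (auto simp: ok_def)
      have "F j \<subseteq> F k" if "j < k" for j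
      proof (cases "j = k - 1")
        case False
        then have "j < k - 1"
          using that by arith
        then show ?thesis
          using legalD(3)[OF l] o(2) by blast
      qed (use o(2) in simp)
      then show "legal_move X C F k"
        using o by (simp add: legal_move_def partial_type_def omissible_iff Z_def)
    next
      assume legal: "\<forall>k. legal_move X C F k"
      define K where "K n = Q closure_of (h ` (Z - F (2 * n + 1)))" for n
      have okn: "ok (2 * n + 1) (F (2 * n)) (F (2 * n + 1))" for n
        using ok[of "2 * n + 1"] legal by simp
      have "\<Inter> (range K) \<noteq> {}"
      proof (rule mcomplete_nest[THEN iffD1, OF Md(2), rule_format], intro conjI allI impI)
        show "closedin mtopology (K n)" for n
          by (simp add: K_def Md(3))
        show "K n \<noteq> {}" for n
          using okn[of n] closure_of_subset[of "h ` (Z - F (2 * n + 1))" Q] h_range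
          by (force simp: K_def ok_def)
        show "decseq K"
          unfolding K_def decseq_def
        proof (intro allI impI closure_of_mono image_mono Diff_mono order_refl)
          fix m n :: nat assume "m \<le> n"
          then show "F (2 * m + 1) \<subseteq> F (2 * n + 1)"
            using legal legalD(3)[of "2 * n + 1" "2 * m + 1"] by (cases "m = n") auto
        qed
        show "\<exists>n a. K n \<subseteq> mcball a \<epsilon>" if \<epsilon>: "\<epsilon> > 0" for \<epsilon>
        proof -
          obtain n where n: "inverse (Suc n) < \<epsilon>"
            using reals_Archimedean[OF \<epsilon>] by blast
          obtain a where a: "K n \<subseteq> mcball a (inverse (Suc (2 * n + 1)))"
            using okn[of n] by (auto simp: K_def ok_def)
          have "inverse (real (Suc (2 * n + 1))) \<le> inverse (real (Suc n))"
            by (rule le_imp_inverse_le) auto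
          then have "mcball a (inverse (Suc (2 * n + 1))) \<subseteq> mcball a \<epsilon>"
            using n by (intro mcball_subset_concentric) linarith
          with a show ?thesis
            by blast
        qed
      qed
      then obtain q where q: "\<And>n. q \<in> K n"
        by blast
      have "q \<notin> N n" for n
        using q[of n] okn[of n] by (auto simp: K_def ok_def)
      moreover have "q \<in> topspace Q"
        using q[of 0] by (simp add: K_def in_closure_of)
      ultimately obtain z where z: "z \<in> Z" "q = h z"
        using N(2) by blast
      have "z \<notin> F (2 * n)" for n
        using q[of n] okn[of n] z by (auto simp: K_def ok_def)
      \<comment> \<open>The moves of even index are cofinal in the play, so avoiding them avoids all
        moves.\<close>
      moreover have "F k \<subseteq> F (2 * k)" for k
        using legal legalD(3)[of "2 * k" k] by (cases "k = 0") auto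
      ultimately have "z \<notin> (\<Union>k. F k)"
        by blast
      moreover have "(\<Union>k. F k) \<subseteq> topspace ?T"
        using legal legalD(1) closedin_subset by blast
      ultimately show "omissible X C (\<Union>k. F k)"
        using z(1) by (auto simp: omissible_def Z_def)
    qed
  qed
  then show ?thesis
    by blast
qed

text \<open>Were the intersection meagre, the strong property could be applied to the closure
  \<open>C'\<close> of the part of \<open>Z\<close> that lies over \<open>U\<close>, with all of
  \<open>S_W X \<inter> C'\<close> as the meagre set to omit; this is absurd. The work lies in
  moving meagreness from \<open>Q\<close> to \<open>C'\<close>, where \<open>Z \<inter> G\<close> is
  dense.\<close>

lemma strong_omitting_types_imp_nonmeagre:
  assumes strong: "strong_omitting_types X" and C: "closedin (omega_types X) C"
    and dc: "dense_copy (omega_types X) (S_W X \<inter> C) Q h"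
    and U: "openin Q U" "U \<noteq> {}"
  shows "\<not> meagre_in Q (U \<inter> h ` (S_W X \<inter> C))"
proof
  let ?T = "omega_types X"
  define Z where "Z = S_W X \<inter> C"
  interpret dense_copy ?T Z Q h
    using dc by (simp add: Z_def)
  assume "meagre_in Q (U \<inter> h ` (S_W X \<inter> C))"
  then obtain N where N: "\<And>n::nat. nowhere_dense_in Q (N n)" "U \<inter> h ` Z = (\<Union>n. N n)"
    using meagre_in_nowhere_dense_sequence unfolding Z_def by metis
  obtain G where G: "openin ?T G" "\<And>z. z \<in> Z \<Longrightarrow> z \<in> G \<longleftrightarrow> h z \<in> U"
    using open_preimage[OF U(1)] by blast
  define C' where "C' = ?T closure_of (Z \<inter> G)"
  let ?TC = "subtopology ?T C'"
  have ZG: "Z \<inter> G \<subseteq> C'"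
    unfolding C'_def using Z_subset by (intro closure_of_subset) auto
  have "C' \<subseteq> C"
    unfolding C'_def by (rule closure_of_minimal[OF _ C]) (auto simp: Z_def)
  have C'T: "C' \<subseteq> topspace ?T"
    by (simp add: C'_def closure_of_subset_topspace)
  have meets: "\<exists>z. z \<in> Z \<and> z \<in> G \<and> z \<in> W" if "openin ?T W" "W \<inter> C' \<noteq> {}" for W
    using that openin_Int_closure_of_eq_empty[of ?T W "Z \<inter> G"] unfolding C'_def by blast
  have "C' = ?T closure_of (S_W X \<inter> C')"
  proof
    have "Z \<inter> G \<subseteq> S_W X \<inter> C'"
      using ZG by (auto simp: Z_def)
    then show "C' \<subseteq> ?T closure_of (S_W X \<inter> C')"
      by (subst C'_def) (rule closure_of_mono)
    show "?T closure_of (S_W X \<inter> C') \<subseteq> C'"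
      by (rule closure_of_minimal) (auto simp: C'_def)
  qed
  moreover have "C' \<noteq> {}"
    using dense[OF U] G(2) ZG by blast
  moreover have "meagre_in ?TC (S_W X \<inter> C')"
  proof -
    have nd: "nowhere_dense_in ?TC {z \<in> Z. h z \<in> N n}" for n
      unfolding nowhere_dense_in_iff
    proof (intro conjI allI impI)
      show "{z \<in> Z. h z \<in> N n} \<subseteq> topspace ?TC"
        using N(2) G(2) ZG C'T by auto
      fix W assume W: "openin ?TC W \<and> W \<noteq> {}"
      then obtain W1 where W1: "openin ?T W1" "W = W1 \<inter> C'"
        by (auto simp: openin_subtopology)
      then obtain z where z: "z \<in> Z" "z \<in> G" "z \<in> W1"
        using W meets by blast
      \<comment> \<open>Nowhere density is transported by a round trip: \<open>W1 \<inter> G\<close>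
        goes to \<open>O1\<close> in \<open>Q\<close>, is shrunk there to \<open>O2\<close> missing
        \<open>N n\<close>, and comes back as \<open>W2\<close>.\<close>
      obtain O1 where O1: "openin Q O1" "\<And>z. z \<in> Z \<Longrightarrow> h z \<in> O1 \<longleftrightarrow> z \<in> W1 \<inter> G"
        using open_image[OF openin_Int[OF W1(1) G(1)]] by blast
      then have "O1 \<inter> U \<noteq> {}"
        using z G(2) by blast
      then obtain O2 where O2: "openin Q O2" "O2 \<noteq> {}" "O2 \<subseteq> O1 \<inter> U" "O2 \<inter> N n = {}"
        using N(1)[of n] openin_Int[OF O1(1) U(1)] unfolding nowhere_dense_in_iff by meson
      obtain W2 where W2: "openin ?T W2" "\<And>z. z \<in> Z \<Longrightarrow> z \<in> W2 \<longleftrightarrow> h z \<in> O2"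
        using open_preimage[OF O2(1)] by blast
      obtain y where y: "y \<in> Z" "h y \<in> O2"
        using dense[OF O2(1,2)] by blast
      show "\<exists>V. openin ?TC V \<and> V \<noteq> {} \<and> V \<subseteq> W \<and> V \<inter> {z \<in> Z. h z \<in> N n} = {}"
      proof (intro exI[of _ "W1 \<inter> W2 \<inter> C'"] conjI)
        show "openin ?TC (W1 \<inter> W2 \<inter> C')"
          using W1(1) W2(1) by (auto simp: openin_subtopology intro!: exI[of _ "W1 \<inter> W2"])
        show "W1 \<inter> W2 \<inter> C' \<noteq> {}"
          using y O1(2) O2(3) W2(2) ZG by blast
        show "W1 \<inter> W2 \<inter> C' \<inter> {z \<in> Z. h z \<in> N n} = {}"
          using W2(2) O2(4) by blast
      qed (use W1(2) in blast)
    qed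
    have "meagre_in ?TC (\<Union>n. {z \<in> Z. h z \<in> N n})"
      by (rule meagre_in_UN) (use nd meagre_in_nowhere_dense in auto)
    \<comment> \<open>Points of \<open>Z\<close> in \<open>C'\<close> but outside \<open>G\<close>
      are not covered by the pullbacks of the \<open>N n\<close>. They lie in \<open>C' - G\<close>,
      which is nowhere dense since \<open>G\<close> is open and contains a dense subset of
      \<open>C'\<close>.\<close>
    moreover have "nowhere_dense_in ?TC (C' - G)"
      unfolding nowhere_dense_in_iff
    proof (intro conjI allI impI)
      show "C' - G \<subseteq> topspace ?TC"
        using C'T by auto
      fix W assume W: "openin ?TC W \<and> W \<noteq> {}"
      then obtain W1 where W1: "openin ?T W1" "W = W1 \<inter> C'"
        by (auto simp: openin_subtopology)
      then obtain z where z: "z \<in> Z" "z \<in> G" "z \<in> W1"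
        using W meets by blast
      show "\<exists>V. openin ?TC V \<and> V \<noteq> {} \<and> V \<subseteq> W \<and> V \<inter> (C' - G) = {}"
      proof (intro exI[of _ "W1 \<inter> G \<inter> C'"] conjI)
        show "openin ?TC (W1 \<inter> G \<inter> C')"
          using W1(1) G(1) by (auto simp: openin_subtopology intro!: exI[of _ "W1 \<inter> G"])
      qed (use W1(2) z ZG in auto)
    qed
    ultimately have "meagre_in ?TC ((\<Union>n. {z \<in> Z. h z \<in> N n}) \<union> (C' - G))"
      using meagre_in_Un meagre_in_nowhere_dense by blast
    moreover have "S_W X \<inter> C' \<subseteq> (\<Union>n. {z \<in> Z. h z \<in> N n}) \<union> (C' - G)"
    proof
      fix z assume z: "z \<in> S_W X \<inter> C'"
      then have "z \<in> Z"
        using \<open>C' \<subseteq> C\<close> by (auto simp: Z_def)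
      then show "z \<in> (\<Union>n. {z \<in> Z. h z \<in> N n}) \<union> (C' - G)"
        using z N(2) G(2) by blast
    qed
    ultimately show ?thesis
      by (rule meagre_in_subset)
  qed
  ultimately have "\<exists>\<sigma>\<in>S_W X \<inter> C'. \<sigma> \<notin> S_W X \<inter> C'"
    using strong[unfolded strong_omitting_types_def, rule_format, of C' "S_W X \<inter> C'"]
    by (simp add: C'_def)
  then show False
    by blast
qed

subsection \<open>Second countability\<close>

lemma Polish_space_imp_second_countable:
  assumes "Polish_space Y"
  shows "second_countable Y"
proof -
  obtain M d where Md: "Metric_space M d" "Y = Metric_space.mtopology M d"
    using assms by (auto simp: Polish_space_def completely_metrizable_space_def)
  interpret Metric_space M d
    by (fact Md(1))
  obtain D where D: "countable D" "D \<subseteq> M" "mtopology closure_of D = M"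
    using assms unfolding Polish_space_def separable_space_def Md(2) by auto
  show ?thesis
    unfolding second_countable_def
  proof (intro exI[of _ "(\<lambda>(c, n). mball c (inverse (Suc n))) ` (D \<times> (UNIV :: nat set))"] conjI allI impI)
    show "countable ((\<lambda>(c, n). mball c (inverse (Suc n))) ` (D \<times> (UNIV :: nat set)))"
      using D(1) by (intro countable_image countable_SIGMA) auto
    show "\<forall>V\<in>(\<lambda>(c, n). mball c (inverse (Suc n))) ` (D \<times> (UNIV :: nat set)). openin Y V"
      unfolding Md(2) by auto
    fix U x assume "openin Y U \<and> x \<in> U"
    then obtain r where r: "r > 0" "mball x r \<subseteq> U" and x: "x \<in> M"
      unfolding Md(2) openin_mtopology by blast
    obtain n where n: "inverse (Suc n) < r / 2"
      using reals_Archimedean[of "r / 2"] r(1) by auto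
    have "x \<in> mtopology closure_of D"
      using D(3) x by simp
    then obtain c where c: "c \<in> D" "c \<in> mball x (inverse (Suc n))"
      using x unfolding in_closure_of
      by (metis centre_in_mball_iff inverse_positive_iff_positive of_nat_0_less_iff openin_mball zero_less_Suc)
    have "mball c (inverse (Suc n)) \<subseteq> mball x r"
    proof
      fix y assume y: "y \<in> mball c (inverse (Suc n))"
      then have "d x y \<le> d x c + d c y"
        using c x by (intro triangle) auto
      also have "\<dots> < r"
        using c y n by auto
      finally show "y \<in> mball x r"
        using x y by auto
    qed
    moreover have "x \<in> mball c (inverse (Suc n))"
      using c by (auto simp: commute)
    ultimately show "\<exists>V\<in>(\<lambda>(c, n). mball c (inverse (Suc n))) ` (D \<times> (UNIV :: nat set)). x \<in> V \<and> V \<subseteq> U"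
      using c(1) r(2) by (intro bexI[of _ "mball c (inverse (Suc n))"]) auto
  qed
qed

lemma second_countable_sequence_space:
  assumes "second_countable Y"
  shows "second_countable (product_topology (\<lambda>_::nat. Y) UNIV)"
proof -
  obtain \<B> where B: "countable \<B>" "\<forall>V\<in>\<B>. openin Y V"
      "\<And>U x. openin Y U \<Longrightarrow> x \<in> U \<Longrightarrow> \<exists>V\<in>\<B>. x \<in> V \<and> V \<subseteq> U"
    using assms unfolding second_countable_def by metis
  define box where "box l = (\<Pi>\<^sub>E i\<in>(UNIV :: nat set). if i < length l then l ! i else topspace Y)" for l
  show ?thesis
    \<comment> \<open>A list of basic sets restricts an initial segment of the coordinates, and
      \<open>box\<close> pads it with the whole space; finite lists over a countable set are
      countable in number.\<close>
    unfolding second_countable_def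
  proof (intro exI[of _ "box ` lists \<B>"] conjI allI impI ballI)
    show "countable (box ` lists \<B>)"
      using B(1) by simp
    fix V assume "V \<in> box ` lists \<B>"
    then obtain l where l: "l \<in> lists \<B>" "V = box l"
      by blast
    have "finite {i. (if i < length l then l ! i else topspace Y) \<noteq> topspace Y}"
      by (rule finite_subset[of _ "{..<length l}"]) (auto split: if_splits)
    moreover have "openin Y (if i < length l then l ! i else topspace Y)" for i
      using l(1) B(2) by (auto simp: in_lists_conv_set)
    ultimately show "openin (product_topology (\<lambda>_::nat. Y) UNIV) V"
      unfolding l(2) box_def openin_PiE_gen by simp
  next
    fix U y assume "openin (product_topology (\<lambda>_::nat. Y) UNIV) U \<and> y \<in> U"
    then obtain V where V: "finite {i. V i \<noteq> topspace Y}" "\<And>i. openin Y (V i)"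
        "y \<in> Pi\<^sub>E UNIV V" "Pi\<^sub>E UNIV V \<subseteq> U"
      unfolding openin_product_topology_alt by auto
    obtain n where n: "\<And>i. V i \<noteq> topspace Y \<Longrightarrow> i < n"
      using V(1) by (metis (mono_tags) finite_nat_set_iff_bounded mem_Collect_eq)
    have "\<forall>i. \<exists>b\<in>\<B>. y i \<in> b \<and> b \<subseteq> V i"
      using B(3) V(2,3) by (meson PiE_mem UNIV_I)
    then obtain b where b: "\<And>i. b i \<in> \<B>" "\<And>i. y i \<in> b i" "\<And>i. b i \<subseteq> V i"
      by metis
    have "y i \<in> topspace Y" for i
      using b(2,3) V(2) openin_subset by blast
    then have "y \<in> box (map b [0..<n])"
      using b(2) by (simp add: box_def PiE_iff)
    moreover have "box (map b [0..<n]) \<subseteq> Pi\<^sub>E UNIV V"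
      unfolding box_def
    proof (rule PiE_mono)
      show "(if i < length (map b [0..<n]) then map b [0..<n] ! i else topspace Y) \<subseteq> V i" for i
        using b(3)[of i] n[of i] by (cases "i < n") auto
    qed
    moreover have "box (map b [0..<n]) \<in> box ` lists \<B>"
      using b(1) by (intro imageI) auto
    ultimately show "\<exists>V\<in>box ` lists \<B>. y \<in> V \<and> V \<subseteq> U"
      using V(4) by (intro bexI[of _ "box (map b [0..<n])"] conjI) (assumption | rule order_trans)+
  qed
qed

subsection \<open>Realizable types\<close>

definition diag :: "(nat \<Rightarrow> nat \<Rightarrow> 'a) \<Rightarrow> nat \<Rightarrow> 'a" where
  "diag \<sigma> i = \<sigma> (Suc i) i"

lemma topspace_omega_types:
  "topspace (omega_types X) =
     {\<sigma>. (\<forall>n. \<sigma> n \<in> (\<Pi>\<^sub>E i\<in>{..<n}. topspace X)) \<and> (\<forall>n m. n < m \<longrightarrow> \<sigma> n = type_map n id (\<sigma> m))}"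
  by (auto simp: omega_types_def type_space_def PiE_iff extensional_def)

lemma omega_types_nth:
  assumes "\<sigma> \<in> topspace (omega_types X)" "i < n"
  shows "\<sigma> n i = diag \<sigma> i"
proof (cases "n = Suc i")
  case False
  then have "\<sigma> (Suc i) = type_map (Suc i) id (\<sigma> n)"
    using assms by (auto simp: topspace_omega_types)
  then have "\<sigma> (Suc i) i = type_map (Suc i) id (\<sigma> n) i"
    by simp
  then show ?thesis
    by (simp add: type_map_def diag_def)
qed (simp add: diag_def)

lemma diag_in_topspace:
  "\<sigma> \<in> topspace (omega_types X) \<Longrightarrow> diag \<sigma> i \<in> topspace X"
  unfolding topspace_omega_types diag_def by (auto simp: PiE_iff)

lemma continuous_map_diag: "continuous_map (omega_types X) X (\<lambda>\<sigma>. diag \<sigma> i)"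
proof -
  have "continuous_map (omega_types X) (type_space X (Suc i)) (\<lambda>\<sigma>. \<sigma> (Suc i))"
    unfolding omega_types_def by (intro continuous_map_from_subtopology) simp
  then have "continuous_map (omega_types X) X (\<lambda>\<sigma>. \<sigma> (Suc i) i)"
    unfolding type_space_def by (rule continuous_map_product_then_coordinatewise) simp
  then show ?thesis
    by (simp add: diag_def)
qed

lemma enum_set_bij: "finite A \<Longrightarrow> bij_betw (enum_set A) {..<card A} A"
  unfolding enum_set_def by (rule bij_betw_nth) auto

text \<open>By coherence the components of \<sigma> agree wherever they are defined, so the one
  selected by \<open>LEAST\<close> can be replaced by \<open>diag \<sigma>\<close>.\<close>

lemma model_of_eq:
  assumes "\<sigma> \<in> topspace (omega_types X)"
  shows "model_of \<sigma> A = (\<lambda>i\<in>{..<card A}. diag \<sigma> (enum_set A i))"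
proof -
  define m where "m = (LEAST m. enum_set A ` {..<card A} \<subseteq> {..<m})"
  have "\<exists>m. enum_set A ` {..<card A} \<subseteq> {..<m}"
    by (meson finite_imageI finite_lessThan finite_nat_iff_bounded)
  then have "enum_set A ` {..<card A} \<subseteq> {..<m}"
    unfolding m_def by (rule LeastI_ex)
  then have "\<sigma> m (enum_set A i) = diag \<sigma> (enum_set A i)" if "i < card A" for i
    using that by (intro omega_types_nth[OF assms]) auto
  then show ?thesis
    unfolding model_of_def omega_type_map_def m_def[symmetric] type_map_def
    by (intro restrict_ext) simp
qed

text \<open>Supplies pairwise distinct new indices for prescribed open conditions; choosing them
  increasingly makes them distinct.\<close>

lemma infinite_inj_choice:
  fixes S :: "nat \<Rightarrow> nat set"
  assumes "\<And>i. infinite (S i)" "finite A"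
  shows "\<exists>b. inj b \<and> (\<forall>i. b i \<in> S i - A)"
proof -
  have "\<exists>b. \<forall>i. b i \<in> S i - A \<and> b i < b (Suc i)"
  proof (rule dependent_nat_choice)
    show "\<exists>x. x \<in> S 0 - A"
      using assms by (metis Diff_infinite_finite ex_in_conv finite.emptyI)
    fix x i
    have "infinite (S (Suc i) - A)"
      using assms by (simp add: Diff_infinite_finite)
    then show "\<exists>y. y \<in> S (Suc i) - A \<and> x < y"
      unfolding infinite_nat_iff_unbounded by blast
  qed
  then obtain b where b: "\<And>i. b i \<in> S i - A" "\<And>i. b i < b (Suc i)"
    by blast
  then have "strict_mono b"
    by (simp add: strict_mono_Suc_iff)
  then show ?thesis
    using b(1) strict_mono_imp_inj_on by blast
qed

text \<open>If only a finite set \<open>A\<close> of indices hits \<open>V\<close>, apply the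
  extension clause to \<open>A\<close> and to the one-point extensions of \<open>M A\<close> by an
  element of \<open>V\<close>. The index realizing the new coordinate hits \<open>V\<close>, so it
  lies in \<open>A\<close>; but \<open>A\<close> is already listed by the first \<open>n\<close>
  coordinates, against injectivity of \<open>g\<close>.\<close>

lemma S_W_imp_infinite:
  assumes \<sigma>: "\<sigma> \<in> S_W X" and V: "openin X V" "V \<noteq> {}"
  shows "infinite {i. diag \<sigma> i \<in> V}"
proof
  define A where "A = {i. diag \<sigma> i \<in> V}"
  define n where "n = card A"
  assume "finite {i. diag \<sigma> i \<in> V}"
  then have fin: "finite A"
    by (simp add: A_def)
  have T: "\<sigma> \<in> topspace (omega_types X)" and "is_model X (model_of \<sigma>)"
    using \<sigma> by (simp_all add: S_W_def)
  \<comment> \<open>The third clause of \<open>is_model\<close> at \<open>A\<close>.\<close>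
  note ext = this(2)[unfolded is_model_def, rule_format, OF fin, THEN conjunct2, THEN conjunct2,
      rule_format, folded n_def]
  have M: "model_of \<sigma> A = (\<lambda>i\<in>{..<n}. diag \<sigma> (enum_set A i))"
    using model_of_eq[OF T] by (simp add: n_def)
  let ?fib = "{x. type_map n id x = model_of \<sigma> A}"
  define U where "U = {x \<in> topspace (type_space X (Suc n)). x n \<in> V} \<inter> ?fib"
  have "continuous_map (type_space X (Suc n)) X (\<lambda>x. x n)"
    unfolding type_space_def by (rule continuous_map_product_projection) simp
  then have "openin (subtopology (type_space X (Suc n)) ?fib) U"
    unfolding U_def openin_subtopology using openin_continuous_map_preimage[OF _ V(1)] by blast
  moreover have "U \<noteq> {}"
  proof -
    obtain v where v: "v \<in> V"
      using V(2) by blast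
    then have "v \<in> topspace X"
      using V(1) openin_subset by blast
    then have "(\<lambda>i\<in>{..<Suc n}. if i = n then v else diag \<sigma> (enum_set A i)) \<in> U"
      using diag_in_topspace[OF T] v
      by (auto simp: U_def type_space_def M type_map_def fun_eq_iff restrict_def)
    then show ?thesis
      by blast
  qed
  ultimately obtain B g where B: "finite B" "card B = Suc n" "A \<subseteq> B" "g permutes {..<Suc n}"
      "\<And>i. i < n \<Longrightarrow> enum_set A i = enum_set B (g i)" "type_map (Suc n) g (model_of \<sigma> B) \<in> U"
    using ext[of "Suc n" U] by auto
  have gn: "g i < Suc n" if "i < Suc n" for i
    using permutes_in_image[OF B(4), of i] that by simp
  have "type_map (Suc n) g (model_of \<sigma> B) n \<in> V"
    using B(6) by (simp add: U_def)
  then have "enum_set B (g n) \<in> A"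
    using gn by (simp add: type_map_def model_of_eq[OF T] B(2) A_def)
  then obtain j where j: "j < n" "enum_set B (g n) = enum_set A j"
    using enum_set_bij[OF fin] unfolding bij_betw_def n_def by (metis imageE lessThan_iff)
  then have "enum_set B (g n) = enum_set B (g j)"
    using B(5) by simp
  then have "g n = g j"
    using enum_set_bij[OF B(1)] gn j(1) unfolding bij_betw_def inj_on_def B(2) by auto
  then show False
    using permutes_inj[OF B(4)] j(1) by (auto dest: injD)
qed

text \<open>The first two clauses follow from the formula for \<open>model_of\<close>. For the
  third, shrink \<open>U\<close> to a box around one of its points \<open>u\<close>: the first
  \<open>n\<close> coordinates are fixed by \<open>M A\<close> and realized by \<open>A\<close>
  itself, and each further one is realized by a fresh index that hits its factor.\<close>

lemma infinite_imp_S_W: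
  assumes T: "\<sigma> \<in> topspace (omega_types X)"
    and inf: "\<And>V. openin X V \<Longrightarrow> V \<noteq> {} \<Longrightarrow> infinite {i. diag \<sigma> i \<in> V}"
  shows "\<sigma> \<in> S_W X"
proof -
  let ?M = "model_of \<sigma>"
  note M = model_of_eq[OF T]
  have "is_model X ?M"
    unfolding is_model_def
  proof (intro allI impI conjI)
    fix A :: "nat set" assume A: "finite A"
    show "?M A \<in> topspace (type_space X (card A))"
      using diag_in_topspace[OF T] by (simp add: M type_space_def)
    show "?M A = type_map (card A) g (?M B)"
      if "finite B \<and> A \<subseteq> B \<and> g ` {..<card A} \<subseteq> {..<card B} \<and>
          (\<forall>i<card A. enum_set A i = enum_set B (g i))" for B g
      using that by (auto simp: M type_map_def fun_eq_iff restrict_def)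
    fix m U
    assume m: "card A \<le> m" and
      U: "openin (subtopology (type_space X m) {x. type_map (card A) id x = ?M A}) U \<and> U \<noteq> {}"
    define n where "n = card A"
    obtain U' where U': "openin (type_space X m) U'" "U = U' \<inter> {x. type_map n id x = ?M A}"
      using U by (auto simp: openin_subtopology n_def)
    obtain u where u: "u \<in> U"
      using U by blast
    then have "u \<in> U'"
      using U'(2) by simp
    obtain V where V: "\<And>i. i < m \<Longrightarrow> openin X (V i)" "u \<in> Pi\<^sub>E {..<m} V" "Pi\<^sub>E {..<m} V \<subseteq> U'"
      using U'(1)[unfolded type_space_def openin_product_topology_alt, rule_format, OF \<open>u \<in> U'\<close>]
      by (metis lessThan_iff)
    have uV: "u i \<in> V i" if "i < m" for i
      using V(2) that by (auto simp: PiE_iff)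
    \<comment> \<open>The value \<open>UNIV\<close> from \<open>m\<close> on is a filler, as the
      choice lemma treats all natural numbers at once.\<close>
    define S where "S i = (if i < m then {j. diag \<sigma> j \<in> V i} else UNIV)" for i
    have "infinite (S i)" for i
      using inf[of "V i"] V(1)[of i] uV[of i] by (auto simp: S_def)
    then obtain b where b: "inj b" "\<And>i. b i \<in> S i - A"
      using infinite_inj_choice[OF _ A] by blast
    \<comment> \<open>\<open>c\<close> lists the indices in the order of the coordinates of
      \<open>u\<close>; \<open>g\<close> will translate this order into the increasing enumeration
      of \<open>B\<close>.\<close>
    define c where "c i = (if i < n then enum_set A i else b i)" for i
    define B where "B = c ` {..<m}"
    have eA: "inj_on (enum_set A) {..<n}" "enum_set A ` {..<n} = A"
      using enum_set_bij[OF A] by (auto simp: bij_betw_def n_def)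
    have c_inj: "inj_on c {..<m}"
    proof (rule inj_onI)
      fix i j assume ij: "c i = c j"
      have "c l \<in> A \<longleftrightarrow> l < n" for l
        using b(2)[of l] eA(2) by (auto simp: c_def)
      then have "i < n \<longleftrightarrow> j < n"
        using ij by metis
      then show "i = j"
        using ij inj_onD[OF eA(1), of i j] injD[OF b(1), of i j]
        by (cases "i < n") (simp_all add: c_def)
    qed
    have B: "finite B" "card B = m"
      using c_inj by (auto simp: B_def card_image)
    have AB: "A \<subseteq> B"
    proof
      fix a assume "a \<in> A"
      then obtain i where "i < n" "a = enum_set A i"
        using eA(2) by (metis imageE lessThan_iff)
      then show "a \<in> B"
        using m by (auto simp: B_def c_def n_def intro!: image_eqI[of _ _ i])
    qed
    have eB: "bij_betw (enum_set B) {..<m} B"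
      using enum_set_bij[OF B(1)] B(2) by simp
    \<comment> \<open>Outside \<open>{..<m}\<close> the map is the identity, as
      \<open>permutes\<close> demands.\<close>
    define g where "g i = (if i < m then inv_into {..<m} (enum_set B) (c i) else i)" for i
    have "bij_betw (inv_into {..<m} (enum_set B) \<circ> c) {..<m} {..<m}"
      using c_inj bij_betw_inv_into[OF eB] by (intro bij_betw_trans) (auto simp: bij_betw_def B_def)
    then have "bij_betw g {..<m} {..<m}"
      by (subst bij_betw_cong[of _ _ "inv_into {..<m} (enum_set B) \<circ> c"]) (auto simp: g_def)
    then have g: "g permutes {..<m}"
      by (rule bij_imp_permutes) (simp add: g_def)
    have eg: "enum_set B (g i) = c i" if "i < m" for i
      using that eB by (auto simp: g_def B_def bij_betw_def intro!: f_inv_into_f)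
    have gm: "g i < m" if "i < m" for i
      using permutes_in_image[OF g, of i] that by simp
    define w where "w = type_map m g (?M B)"
    have w: "w = (\<lambda>i\<in>{..<m}. diag \<sigma> (c i))"
      using gm eg by (auto simp: w_def M type_map_def B(2) fun_eq_iff restrict_def)
    have wA: "type_map n id w = ?M A"
      using m by (auto simp: w M type_map_def n_def c_def fun_eq_iff restrict_def)
    have "w i \<in> V i" if i: "i < m" for i
    proof (cases "i < n")
      case True
      \<comment> \<open>Both \<open>u\<close> and \<open>w\<close> restrict to \<open>M A\<close>,
        so they agree on the first \<open>n\<close> coordinates.\<close>
      have "type_map n id u = ?M A"
        using u U'(2) by simp
      then have "type_map n id u i = type_map n id w i"
        using wA by simp
      then show ?thesis
        using uV[OF i] True by (simp add: type_map_def)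
    next
      case False
      then show ?thesis
        using i b(2)[of i] by (simp add: w c_def S_def)
    qed
    then have "w \<in> Pi\<^sub>E {..<m} V"
      by (auto simp: w)
    then have "w \<in> U"
      using V(3) U'(2) wA by blast
    then show "\<exists>B g. finite B \<and> card B = m \<and> A \<subseteq> B \<and> g permutes {..<m} \<and>
                 (\<forall>i<card A. enum_set A i = enum_set B (g i)) \<and> type_map m g (?M B) \<in> U"
      using B AB g eg m unfolding w_def
      by (intro exI[of _ B] exI[of _ g]) (auto simp: c_def n_def)
  qed
  then show ?thesis
    using T by (simp add: S_W_def)
qed

text \<open>Visiting an open set infinitely often means visiting it at or after every
  \<open>k\<close>, an open condition for each \<open>k\<close>. It suffices to test the nonempty
  members of a countable base.\<close>

lemma S_W_Gdelta:
  assumes "second_countable X"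
  shows "\<exists>\<V>. countable \<V> \<and> (\<forall>V\<in>\<V>. openin (omega_types X) V) \<and>
             S_W X = {\<sigma> \<in> topspace (omega_types X). \<forall>V\<in>\<V>. \<sigma> \<in> V}"
proof -
  obtain \<B> where B: "countable \<B>" "\<forall>V\<in>\<B>. openin X V"
      "\<And>U x. openin X U \<Longrightarrow> x \<in> U \<Longrightarrow> \<exists>V\<in>\<B>. x \<in> V \<and> V \<subseteq> U"
    using assms unfolding second_countable_def by metis
  let ?T = "omega_types X"
  define hits where "hits = (\<lambda>(V, k::nat). {\<sigma> \<in> topspace ?T. \<exists>i\<ge>k. diag \<sigma> i \<in> V})"
  have "S_W X = {\<sigma> \<in> topspace ?T. \<forall>V\<in>hits ` ((\<B> - {{}}) \<times> UNIV). \<sigma> \<in> V}"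
  proof (intro set_eqI iffI)
    fix \<sigma> assume \<sigma>: "\<sigma> \<in> S_W X"
    then have T: "\<sigma> \<in> topspace ?T"
      by (simp add: S_W_def)
    have "\<exists>i\<ge>k. diag \<sigma> i \<in> V" if "V \<in> \<B>" "V \<noteq> {}" for V k
      using S_W_imp_infinite[OF \<sigma>, of V] B(2) that unfolding infinite_nat_iff_unbounded_le by auto
    then show "\<sigma> \<in> {\<sigma> \<in> topspace ?T. \<forall>V\<in>hits ` ((\<B> - {{}}) \<times> UNIV). \<sigma> \<in> V}"
      using T by (auto simp: hits_def)
  next
    fix \<sigma> assume "\<sigma> \<in> {\<sigma> \<in> topspace ?T. \<forall>V\<in>hits ` ((\<B> - {{}}) \<times> UNIV). \<sigma> \<in> V}"
    then have T: "\<sigma> \<in> topspace ?T" and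
      hit: "\<And>V k. V \<in> \<B> \<Longrightarrow> V \<noteq> {} \<Longrightarrow> \<exists>i\<ge>k. diag \<sigma> i \<in> V"
      by (auto simp: hits_def)
    show "\<sigma> \<in> S_W X"
    proof (rule infinite_imp_S_W[OF T])
      fix V assume V: "openin X V" "V \<noteq> {}"
      then obtain W where "W \<in> \<B>" "W \<noteq> {}" "W \<subseteq> V"
        using B(3)[OF V(1)] by blast
      then show "infinite {i. diag \<sigma> i \<in> V}"
        using hit unfolding infinite_nat_iff_unbounded_le by blast
    qed
  qed
  moreover have "countable (hits ` ((\<B> - {{}}) \<times> UNIV))"
    using B(1) by (intro countable_image countable_SIGMA) auto
  moreover have "openin ?T (hits (V, k))" if "V \<in> \<B>" for V k
  proof -
    have "hits (V, k) = (\<Union>i\<in>{k..}. {\<sigma> \<in> topspace ?T. diag \<sigma> i \<in> V})"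
      by (auto simp: hits_def)
    moreover have "openin ?T {\<sigma> \<in> topspace ?T. diag \<sigma> i \<in> V}" for i
      using openin_continuous_map_preimage[OF continuous_map_diag] B(2) that by blast
    ultimately show ?thesis
      by auto
  qed
  ultimately show ?thesis
    by (intro exI[of _ "hits ` ((\<B> - {{}}) \<times> UNIV)"]) auto
qed

subsection \<open>Sequences in the ambient Polish space\<close>

lemma omega_types_embedding:
  fixes Y :: "'b topology"
  assumes \<phi>: "homeomorphic_maps X (subtopology Y A) \<phi> \<psi>" and AY: "A \<subseteq> topspace Y"
    and P: "P = product_topology (\<lambda>_::nat. Y) UNIV"
  obtains h :: "(nat \<Rightarrow> nat \<Rightarrow> 'a) \<Rightarrow> nat \<Rightarrow> 'b" and k :: "(nat \<Rightarrow> 'b) \<Rightarrow> nat \<Rightarrow> nat \<Rightarrow> 'a" where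
    "continuous_map (omega_types X) P h"
    "\<And>\<sigma>. \<sigma> \<in> topspace (omega_types X) \<Longrightarrow> h \<sigma> \<in> UNIV \<rightarrow> A \<and> k (h \<sigma>) = \<sigma>"
    "continuous_map (subtopology P (UNIV \<rightarrow> A)) (omega_types X) k"
    "\<And>y. y \<in> UNIV \<rightarrow> A \<Longrightarrow> h (k y) = y"
proof -
  define h where "h = (\<lambda>\<sigma> i. \<phi> (diag \<sigma> i))"
  define k where "k = (\<lambda>y n. \<lambda>i\<in>{..<n::nat}. \<psi> (y i))"
  have \<phi>c: "continuous_map X (subtopology Y A) \<phi>" and \<psi>c: "continuous_map (subtopology Y A) X \<psi>"
    and \<psi>\<phi>: "\<And>x. x \<in> topspace X \<Longrightarrow> \<psi> (\<phi> x) = x" and \<phi>\<psi>: "\<And>y. y \<in> A \<Longrightarrow> \<phi> (\<psi> y) = y"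
    using \<phi> AY by (auto simp: homeomorphic_maps_def)
  have \<phi>A: "\<And>x. x \<in> topspace X \<Longrightarrow> \<phi> x \<in> A"
    using \<phi>c by (auto simp: continuous_map_def)
  have "continuous_map X Y \<phi>"
    using \<phi>c continuous_map_into_fulltopology by blast
  then have "continuous_map (omega_types X) Y (\<lambda>\<sigma>. \<phi> (diag \<sigma> i))" for i
    using continuous_map_compose[OF continuous_map_diag] by (auto simp: o_def)
  then have h: "continuous_map (omega_types X) P h"
    unfolding P h_def continuous_map_componentwise_UNIV by blast
  have kh: "h \<sigma> \<in> UNIV \<rightarrow> A \<and> k (h \<sigma>) = \<sigma>" if \<sigma>: "\<sigma> \<in> topspace (omega_types X)" for \<sigma>
  proof
    show "h \<sigma> \<in> (UNIV \<rightarrow> A)"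
      using \<phi>A diag_in_topspace[OF \<sigma>] by (auto simp: h_def)
    show "k (h \<sigma>) = \<sigma>"
    proof (intro ext)
      fix n i
      have "\<sigma> n \<in> extensional {..<n}"
        using \<sigma> by (auto simp: topspace_omega_types PiE_iff)
      then show "k (h \<sigma>) n i = \<sigma> n i"
        using \<psi>\<phi> diag_in_topspace[OF \<sigma>] omega_types_nth[OF \<sigma>, of i n]
        by (simp add: k_def h_def restrict_def extensional_def)
    qed
  qed
  let ?PA = "subtopology P (UNIV \<rightarrow> A)"
  have coord: "continuous_map ?PA X (\<lambda>y. \<psi> (y i))" for i
  proof -
    have "continuous_map ?PA Y (\<lambda>y. y i)"
      unfolding P by (intro continuous_map_from_subtopology continuous_map_product_projection) simp
    then have "continuous_map ?PA (subtopology Y A) (\<lambda>y. y i)"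
      by (auto simp: continuous_map_in_subtopology)
    then show ?thesis
      using continuous_map_compose[OF _ \<psi>c] by (auto simp: o_def)
  qed
  have "continuous_map ?PA (type_space X n) (\<lambda>y. k y n)" for n
    unfolding type_space_def continuous_map_componentwise
    using coord by (auto simp: k_def)
  then have k: "continuous_map ?PA (omega_types X) k"
    unfolding omega_types_def continuous_map_in_subtopology continuous_map_componentwise_UNIV
    by (auto simp: k_def type_map_def restrict_def fun_eq_iff)
  have hk: "h (k y) = y" if "y \<in> UNIV \<rightarrow> A" for y
    using that \<phi>\<psi> by (auto simp: h_def k_def diag_def fun_eq_iff)
  show thesis
    by (rule that[OF h kh k hk])
qed

lemma strong_imp_game_omitting_types:
  assumes Y: "Polish_space Y" and A: "coanalytic_in Y A"
    and XA: "X homeomorphic_space subtopology Y A" and strong: "strong_omitting_types X"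
  shows "game_omitting_types X"
  unfolding game_omitting_types_def partial_type_def
proof (intro allI impI)
  fix C assume C: "closedin (omega_types X) C"
  let ?T = "omega_types X"
  define Z where "Z = S_W X \<inter> C"
  have AY: "A \<subseteq> topspace Y" and an: "analytic_in Y (topspace Y - A)"
    using A by (auto simp: coanalytic_in_def)
  have Ycm: "completely_metrizable_space Y" and Ysc: "second_countable Y"
    using Y Polish_space_imp_second_countable by (auto simp: Polish_space_def)
  have Xsc: "second_countable X"
    using homeomorphic_space_second_countability[OF XA] second_countable_subtopology[OF Ysc] by blast
  obtain \<phi> \<psi> where \<phi>: "homeomorphic_maps X (subtopology Y A) \<phi> \<psi>"
    using XA by (auto simp: homeomorphic_space_def)
  define P where "P = product_topology (\<lambda>_::nat. Y) UNIV"
  obtain h k where emb: "continuous_map ?T P h"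
    "\<And>\<sigma>. \<sigma> \<in> topspace ?T \<Longrightarrow> h \<sigma> \<in> UNIV \<rightarrow> A \<and> k (h \<sigma>) = \<sigma>"
    "continuous_map (subtopology P (UNIV \<rightarrow> A)) ?T k"
    "\<And>y. y \<in> UNIV \<rightarrow> A \<Longrightarrow> h (k y) = y"
    using omega_types_embedding[OF \<phi> AY P_def] by metis
  have ZT: "Z \<subseteq> topspace ?T"
    by (auto simp: Z_def S_W_def)
  have hA: "h z \<in> UNIV \<rightarrow> A" "k (h z) = z" if "z \<in> Z" for z
    using emb(2)[of z] ZT that by auto
  have hP: "h z \<in> topspace P" if "z \<in> Z" for z
    using hA(1)[OF that] AY by (auto simp: P_def)
  define K where "K = P closure_of (h ` Z)"
  define Q where "Q = subtopology P K"
  have KP: "K \<subseteq> topspace P"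
    by (simp add: K_def closure_of_subset_topspace)
  have hK: "h z \<in> K" if "z \<in> Z" for z
    using closure_of_subset[of "h ` Z" P] hP that by (auto simp: K_def)
  have topQ: "topspace Q = K"
    using KP by (auto simp: Q_def)
  have pull: "\<exists>W. openin P W \<and> (\<forall>y\<in>UNIV \<rightarrow> A. y \<in> W \<longleftrightarrow> k y \<in> V)" if V: "openin ?T V" for V
  proof -
    have "topspace (subtopology P (UNIV \<rightarrow> A)) = (UNIV \<rightarrow> A)"
      using AY by (auto simp: P_def)
    then obtain W where "openin P W" "{y \<in> UNIV \<rightarrow> A. k y \<in> V} = W \<inter> (UNIV \<rightarrow> A)"
      using openin_continuous_map_preimage[OF emb(3) V] by (auto simp: openin_subtopology)
    then show ?thesis
      by (intro exI[of _ W]) blast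
  qed
  have meets: "\<exists>z\<in>Z. h z \<in> W" if "openin P W" "W \<inter> K \<noteq> {}" for W
    using that openin_Int_closure_of_eq_empty[of P W "h ` Z"] by (auto simp: K_def)
  have dc: "dense_copy ?T Z Q h"
  proof
    show "h ` Z \<subseteq> topspace Q"
      using hK topQ by blast
    show "\<exists>W. openin Q W \<and> (\<forall>z\<in>Z. h z \<in> W \<longleftrightarrow> z \<in> V)" if "openin ?T V" for V
    proof -
      obtain W where W: "openin P W" "\<forall>y\<in>UNIV \<rightarrow> A. y \<in> W \<longleftrightarrow> k y \<in> V"
        using pull[OF \<open>openin ?T V\<close>] by blast
      have "openin Q (W \<inter> K)"
        using W(1) by (auto simp: Q_def openin_subtopology)
      moreover have "h z \<in> W \<inter> K \<longleftrightarrow> z \<in> V" if "z \<in> Z" for z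
        using W(2) hA[OF that] hK[OF that] by simp
      ultimately show ?thesis
        by blast
    qed
    show "\<exists>V. openin ?T V \<and> (\<forall>z\<in>Z. z \<in> V \<longleftrightarrow> h z \<in> W)" if W: "openin Q W" for W
    proof -
      obtain W' where W': "openin P W'" "W = W' \<inter> K"
        using W by (auto simp: Q_def openin_subtopology)
      have "openin ?T {\<sigma> \<in> topspace ?T. h \<sigma> \<in> W'}"
        by (rule openin_continuous_map_preimage[OF emb(1) W'(1)])
      then show ?thesis
        using W'(2) hK ZT by (intro exI[of _ "{\<sigma> \<in> topspace ?T. h \<sigma> \<in> W'}"]) auto
    qed
    show "\<exists>z\<in>Z. h z \<in> W" if W: "openin Q W" "W \<noteq> {}" for W
    proof -
      obtain W' where W': "openin P W'" "W = W' \<inter> K"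
        using W(1) by (auto simp: Q_def openin_subtopology)
      then show ?thesis
        using meets[OF W'(1)] W(2) hK by auto
    qed
  qed (rule ZT)
  have Pcm: "completely_metrizable_space P"
    unfolding P_def completely_metrizable_space_product_topology using Ycm by auto
  then have Qcm: "completely_metrizable_space Q"
    unfolding Q_def K_def by (rule completely_metrizable_space_closedin) simp
  have Qsc: "second_countable Q"
    unfolding Q_def P_def
    by (intro second_countable_subtopology second_countable_sequence_space Ysc)
  have large: "\<not> meagre_in Q (U \<inter> h ` Z)" if "openin Q U" "U \<noteq> {}" for U
    using strong_omitting_types_imp_nonmeagre[OF strong C _ that] dc by (simp add: Z_def)

  \<comment> \<open>Co-analyticity enters here. The set \<open>?B\<close> equals an open
    \<open>G\<close> up to meagre sets and is disjoint from \<open>h\<close> Z\<open>, so\<close>h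
    \<open>Z\<close> is meagre in \<open>G\<close>; by \<open>large\<close>, \<open>G\<close> is
    empty.\<close>
  have outside: "meagre_in Q {y \<in> topspace Q. y i \<in> topspace Y - A}" for i
  proof -
    let ?B = "{y \<in> topspace Q. y i \<in> topspace Y - A}"
    have "continuous_map Q Y (\<lambda>y. y i)"
      unfolding Q_def P_def
      by (intro continuous_map_from_subtopology continuous_map_product_projection) simp
    moreover have "Hausdorff_space Y"
      using Ycm by (simp add: completely_metrizable_imp_metrizable_space metrizable_imp_Hausdorff_space)
    ultimately obtain G where G: "openin Q G" "meagre_in Q (?B - G)" "meagre_in Q (G - ?B)"
      using analytic_preimage_Baire_property[OF Qsc _ _ an] by blast
    have "G \<inter> h ` Z \<subseteq> G - ?B"
      using hA(1) by auto
    then have "meagre_in Q (G \<inter> h ` Z)"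
      using meagre_in_subset[OF G(3)] by blast
    then have "G = {}"
      using large G(1) by blast
    then show ?thesis
      using G(2) by simp
  qed
  obtain \<V> where \<V>: "countable \<V>" "\<And>V. V \<in> \<V> \<Longrightarrow> openin ?T V"
      "S_W X = {\<sigma> \<in> topspace ?T. \<forall>V\<in>\<V>. \<sigma> \<in> V}"
    using S_W_Gdelta[OF Xsc] by blast
  have inside: "nowhere_dense_in Q {y \<in> K. y \<in> UNIV \<rightarrow> A \<and> k y \<notin> V}" if V: "V \<in> \<V>" for V
    unfolding nowhere_dense_in_iff
  proof (intro conjI allI impI)
    show "{y \<in> K. y \<in> UNIV \<rightarrow> A \<and> k y \<notin> V} \<subseteq> topspace Q"
      using topQ by blast
    obtain W where W: "openin P W" "\<forall>y\<in>UNIV \<rightarrow> A. y \<in> W \<longleftrightarrow> k y \<in> V"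
      using pull[OF \<V>(2)[OF V]] by blast
    fix U assume U: "openin Q U \<and> U \<noteq> {}"
    then obtain U' where U': "openin P U'" "U = U' \<inter> K"
      by (auto simp: Q_def openin_subtopology)
    then obtain z where z: "z \<in> Z" "h z \<in> U'"
      using meets[OF U'(1)] U by auto
    then have "z \<in> V"
      using \<V>(3) V by (auto simp: Z_def)
    then have "h z \<in> W"
      using W(2) hA[OF z(1)] by simp
    then have "U \<inter> W \<noteq> {}"
      using z U'(2) hK by blast
    moreover have "openin Q (U \<inter> W)"
      using U' W(1) by (auto simp: Q_def openin_subtopology intro!: exI[of _ "U' \<inter> W"])
    ultimately show "\<exists>V'. openin Q V' \<and> V' \<noteq> {} \<and> V' \<subseteq> U \<and> V' \<inter> {y \<in> K. y \<in> UNIV \<rightarrow> A \<and> k y \<notin> V} = {}"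
      using W(2) by (intro exI[of _ "U \<inter> W"]) auto
  qed
  have "meagre_in Q ((\<Union>i. {y \<in> topspace Q. y i \<in> topspace Y - A}) \<union>
          (\<Union>V\<in>\<V>. {y \<in> K. y \<in> UNIV \<rightarrow> A \<and> k y \<notin> V}))"
  proof (intro meagre_in_Un)
    show "meagre_in Q (\<Union>i. {y \<in> topspace Q. y i \<in> topspace Y - A})"
      by (rule meagre_in_UN) (simp_all only: outside countableI_type)
    show "meagre_in Q (\<Union>V\<in>\<V>. {y \<in> K. y \<in> UNIV \<rightarrow> A \<and> k y \<notin> V})"
      by (rule meagre_in_UN[OF \<V>(1)]) (rule meagre_in_nowhere_dense[OF inside])
  qed
  moreover have "topspace Q - h ` Z \<subseteq> (\<Union>i. {y \<in> topspace Q. y i \<in> topspace Y - A}) \<union>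
          (\<Union>V\<in>\<V>. {y \<in> K. y \<in> UNIV \<rightarrow> A \<and> k y \<notin> V})"
  proof
    fix y assume y: "y \<in> topspace Q - h ` Z"
    then have yK: "y \<in> K"
      by (simp add: topQ)
    have yY: "y i \<in> topspace Y" for i
      using yK KP by (auto simp: P_def PiE_iff)
    show "y \<in> (\<Union>i. {y \<in> topspace Q. y i \<in> topspace Y - A}) \<union>
          (\<Union>V\<in>\<V>. {y \<in> K. y \<in> UNIV \<rightarrow> A \<and> k y \<notin> V})"
    proof (rule ccontr)
      assume not: "\<not> ?thesis"
      then have yA: "y \<in> UNIV \<rightarrow> A"
        using yK yY topQ by blast
      then have "y \<in> topspace (subtopology P (UNIV \<rightarrow> A))"
        using yK KP by auto
      then have kT: "k y \<in> topspace ?T"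
        using emb(3) by (auto simp: continuous_map_def)
      moreover have "\<forall>V\<in>\<V>. k y \<in> V"
        using not yA yK by blast
      ultimately have "k y \<in> S_W X"
        using \<V>(3) by blast
      moreover have "k y \<in> C"
      proof (rule ccontr)
        assume "k y \<notin> C"
        obtain W where W: "openin P W" "\<forall>y\<in>UNIV \<rightarrow> A. y \<in> W \<longleftrightarrow> k y \<in> topspace ?T - C"
          using pull[OF openin_diff[OF openin_topspace C]] by blast
        then have "y \<in> W"
          using yA kT \<open>k y \<notin> C\<close> by blast
        then obtain z where "z \<in> Z" "h z \<in> W"
          using meets[OF W(1)] yK by blast
        then show False
          using W(2) hA[of z] by (auto simp: Z_def)
      qed
      ultimately have "k y \<in> Z"
        by (simp add: Z_def)
      then show False
        using emb(4)[OF yA] y by (metis DiffE imageI)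
    qed
  qed
  ultimately have "meagre_in Q (topspace Q - h ` Z)"
    by (rule meagre_in_subset)
  then show "\<exists>s. omit_winning_strategy X C s"
    using omit_winning_strategy_comeagre[OF _ Qcm] dc unfolding Z_def by blast
qed

theorem theorem3p1:
  fixes X :: "'a topology" and Y :: "'b topology" and A :: "'b set"
  assumes "metrizable_space X" and "separable_space X"
    and "Polish_space Y" and "coanalytic_in Y A"
    and "X homeomorphic_space subtopology Y A"
  shows "game_omitting_types X \<longleftrightarrow> strong_omitting_types X"
  using game_imp_strong_omitting_types strong_imp_game_omitting_types assms by blast

end
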